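(* Let $\mathcal{F}$ be a family of pairs $(f,g)$ of non-negative measurable functions on $\mathbb{R}^n$. Suppose that for some $p_0,q_0$, $1<p_0\le q_0<\infty$, and every $w_0\in A_{p_0,q_0}$, $$\Big(\int_{\mathbb{R}^n}f(x)^{q_0}w_0(x)^{q_0}\,dx\Big)^{1/q_0}\le C\Big(\int_{\mathbb{R}^n}g(x)^{p_0}w_0(x)^{p_0}\,dx\Big)^{1/p_0},\qquad(f,g)\in\mathcal{F}.$$ Given $p(\cdot),q(\cdot)\in\mathcal{P}$, suppose $$\frac1{p(x)}-\frac1{q(x)}=\frac1{p_0}-\frac1{q_0}.$$ Define $\sigma\ge1$ by $1/\sigma'=1/p_0-1/q_0$ (where $1/\sigma+1/\sigma'=1$). If $w\in A_{p(\cdot),q(\cdot)}$ and $(q(\cdot)/\sigma,w^\sigma)$ is an $M$-pair, then $$\|f\|_{L^{q(\cdot)}(w)}\le C\|g\|_{L^{p(\cdot)}(w)},\qquad(f,g)\in\mathcal{F}.$$ The theorem holds if $p_0=1$ (i.e. if the hypothesis holds with $p_0=1$ and every $w_0\in A_{1,q_0}$) if we assume only that the maximal operator $M$ is bounded on $L^{(q(\cdot)/q_0)'}(w^{-q_0})$.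
   Context: $\mathcal{P}$ is the set of measurable $p(\cdot):\mathbb{R}^n\to[1,\infty]$. The conjugate exponent $p'(\cdot)$ is defined pointwise by $1/p(x)+1/p'(x)=1$ with $1/\infty=0$. With $\mathbb{R}^n_\infty=\{x:p(x)=\infty\}$, $$\|f\|_{p(\cdot)}=\inf\Big\{\lambda>0:\int_{\mathbb{R}^n\setminus\mathbb{R}^n_\infty}\Big(\frac{|f(x)|}{\lambda}\Big)^{p(x)}dx+\lambda^{-1}\|f\|_{L^\infty(\mathbb{R}^n_\infty)}\le1\Big\}.$$ A weight is a non-negative measurable function; the weight $w$ used with variable exponents satisfies $0<w(x)<\infty$ a.e. $L^{p(\cdot)}(w)$ is the set of measurable $f$ with $\|f\|_{L^{p(\cdot)}(w)}:=\|fw\|_{p(\cdot)}<\infty$. $Mf(x)=\sup_{B\ni x}\frac1{|B|}\int_B|f(y)|\,dy$, supremum over balls $B$ containing $x$. $M$ is bounded on $L^{p(\cdot)}(w)$ if $\|(Mf)w\|_{p(\cdot)}\le C\|fw\|_{p(\cdot)}$ for all $f\in L^{p(\cdot)}(w)$. $(p(\cdot),w)$, with $p(\cdot)\in\mathcal{P}$, is an $M$-pair if $M$ is bounded on both $L^{p(\cdot)}(w)$ and $L^{p'(\cdot)}(w^{-1})$. For constants $1<p\le q<\infty$, $w_0\in A_{p,q}$ iff $\sup_B\big(\frac1{|B|}\int_Bw_0^q\,dx\big)^{1/q}\big(\frac1{|B|}\int_Bw_0^{-p'}\,dx\big)^{1/p'}<\infty$; $w_0\in A_{1,q}$ iff $\sup_B\frac{|B|^{-1}\int_Bw_0^q\,dx}{\operatorname{ess\,inf}_{x\in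 B}w_0(x)^q}<\infty$. For $p(\cdot),q(\cdot)\in\mathcal{P}$ with $\frac1{p(x)}-\frac1{q(x)}=\gamma$ for a constant $\gamma\in[0,1)$, $w\in A_{p(\cdot),q(\cdot)}$ iff $0<w<\infty$ a.e. and $\sup_B|B|^{\gamma-1}\|w\chi_B\|_{q(\cdot)}\|w^{-1}\chi_B\|_{p'(\cdot)}<\infty$. All suprema are over balls $B\subset\mathbb{R}^n$. Convention: an inequality over $(f,g)\in\mathcal{F}$ means that it holds, with $C$ independent of the pair, for every pair $(f,g)\in\mathcal{F}$ for which the left-hand side is finite. *)

theory Defs
  imports "HOL-Analysis.Analysis" "HOL-Probability.Essential_Supremum"
begin

text \<open>
  Non-negative measurable functions and weights take values in \<^typ>\<open>ennreal\<close>, i.e. in $[0,\infty]$,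
  and measurable means Lebesgue measurable.  Recall that \<open>0 * \<infinity> = 0\<close> and \<open>0 / 0 = \<infinity> / \<infinity> = 0\<close> in
  \<^typ>\<open>ennreal\<close>.
\<close>

definition epowr :: "ennreal \<Rightarrow> real \<Rightarrow> ennreal"  (infixr \<open>epowr\<close> 80) where
  "x epowr a =
     (if a = 0 then 1
      else if x = 0 then (if a > 0 then 0 else \<infinity>)
      else if x = \<infinity> then (if a > 0 then \<infinity> else 0)
      else ennreal (enn2real x powr a))"

definition exponents :: "('a::euclidean_space \<Rightarrow> ennreal) set" where
  "exponents = {p. p \<in> borel_measurable lebesgue \<and> (\<forall>x. 1 \<le> p x)}"

text \<open>
  The conjugate exponent on $[1,\infty]$; \<open>conj_exp_eq\<close> and \<open>conj_exp_unique\<close> below confirm that it is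
  the unique solution of $1/r + 1/r' = 1$.
\<close>

definition conj_exp :: "ennreal \<Rightarrow> ennreal" where
  "conj_exp r = 1 / (1 - 1 / r)"

lemma conj_exp_unique:
  assumes "1 / r + 1 / s = (1 :: ennreal)"
  shows "s = conj_exp r"
proof -
  have "1 / r \<le> 1"
    using assms by (metis le_iff_add)
  hence "1 / r \<noteq> \<infinity>"
    by (auto simp: top_unique)
  hence "1 / s = 1 - 1 / r"
    using assms by (metis ennreal_add_diff_cancel_left infinity_ennreal_def)
  moreover have "s = inverse (inverse s)"
    by (cases s; cases "s = 0") (auto simp: inverse_ennreal less_le)
  ultimately show ?thesis
    by (simp add: conj_exp_def divide_ennreal_def)
qed

lemma conj_exp_eq:
  assumes "1 \<le> r"
  shows "1 / r + 1 / conj_exp r = 1"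
proof -
  have le: "inverse r \<le> 1"
    using assms
    by (cases r) (auto simp: inverse_ennreal field_simps ennreal_le_1 simp flip: ennreal_1)
  moreover have "inverse (inverse s) = s" for s :: ennreal
    by (cases s; cases "s = 0") (auto simp: inverse_ennreal less_le)
  ultimately show ?thesis
    by (simp add: conj_exp_def divide_ennreal_def add_diff_inverse_ennreal)
qed

text \<open>
  The functional $\|\cdot\|_{p(\cdot)}$, with the convention $\inf\emptyset = \infty$.  The argument
  stands for $|f|$, and \<^const>\<open>esssup\<close> over a null set is $0$.
\<close>

definition var_norm :: "('a::euclidean_space \<Rightarrow> ennreal) \<Rightarrow> ('a \<Rightarrow> ennreal) \<Rightarrow> ennreal" where
  "var_norm p f =
     (INF l \<in> {l::real. l > 0 \<and>
          (\<integral>\<^sup>+x\<in>{x. p x \<noteq> \<infinity>}. (f x / ennreal l) epowr enn2real (p x) \<partial>lebesgue)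
          + esssup (restrict_space lebesgue {x. p x = \<infinity>}) f / ennreal l \<le> 1}. ennreal l)"

definition weighted_norm ::
  "('a::euclidean_space \<Rightarrow> ennreal) \<Rightarrow> ('a \<Rightarrow> ennreal) \<Rightarrow> ('a \<Rightarrow> ennreal) \<Rightarrow> ennreal" where
  "weighted_norm p w f = var_norm p (\<lambda>x. f x * w x)"

definition balls :: "'a::euclidean_space set set" where
  "balls = {ball c r |c r. r > 0}"

definition avg :: "'a::euclidean_space set \<Rightarrow> ('a \<Rightarrow> ennreal) \<Rightarrow> ennreal" where
  "avg B f = (\<integral>\<^sup>+x\<in>B. f x \<partial>lebesgue) / emeasure lebesgue B"

definition maximal :: "('a::euclidean_space \<Rightarrow> real) \<Rightarrow> 'a \<Rightarrow> ennreal" where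
  "maximal f x = (SUP B \<in> {B \<in> balls. x \<in> B}. avg B (\<lambda>y. ennreal \<bar>f y\<bar>))"

definition maximal_bounded :: "('a::euclidean_space \<Rightarrow> ennreal) \<Rightarrow> ('a \<Rightarrow> ennreal) \<Rightarrow> bool" where
  "maximal_bounded p w \<longleftrightarrow>
     (\<exists>C::real. C > 0 \<and>
        (\<forall>f \<in> borel_measurable lebesgue.
           weighted_norm p w (\<lambda>x. ennreal \<bar>f x\<bar>) < \<infinity> \<longrightarrow>
           weighted_norm p w (maximal f) \<le> ennreal C * weighted_norm p w (\<lambda>x. ennreal \<bar>f x\<bar>)))"

definition M_pair :: "('a::euclidean_space \<Rightarrow> ennreal) \<Rightarrow> ('a \<Rightarrow> ennreal) \<Rightarrow> bool" where
  "M_pair p w \<longleftrightarrow> p \<in> exponents \<and> maximal_bounded p w \<and>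
     maximal_bounded (\<lambda>x. conj_exp (p x)) (\<lambda>x. w x epowr (-1))"

definition var_weights :: "('a::euclidean_space \<Rightarrow> ennreal) set" where
  "var_weights =
     {w. w \<in> borel_measurable lebesgue \<and> (AE x in lebesgue. 0 < w x \<and> w x < \<infinity>)}"

definition essinf_on :: "'a::euclidean_space set \<Rightarrow> ('a \<Rightarrow> ennreal) \<Rightarrow> ennreal" where
  "essinf_on B f = Sup {c. AE x in lebesgue. x \<in> B \<longrightarrow> c \<le> f x}"

text \<open>
  $A_{p,q}$ for constants $1 \le p \le q < \infty$.  Under the conventions for \<open>0 * \<infinity>\<close>, \<open>0 / 0\<close> and
  \<open>\<infinity> / \<infinity>\<close> the functions that are a.e. $0$ or a.e. $\infty$ also belong to the class.  For them, a
  weighted inequality asserted only for pairs with finite left-hand side holds trivially, because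
  that side is then $0$.
\<close>

definition A_const :: "real \<Rightarrow> real \<Rightarrow> ('a::euclidean_space \<Rightarrow> ennreal) set" where
  "A_const p q = {w. w \<in> borel_measurable lebesgue \<and>
     (if p = 1
      then (SUP B\<in>balls. avg B (\<lambda>x. w x epowr q) / essinf_on B (\<lambda>x. w x epowr q)) < \<infinity>
      else (SUP B\<in>balls. avg B (\<lambda>x. w x epowr q) epowr (1 / q) *
              avg B (\<lambda>x. w x epowr (- (p / (p - 1)))) epowr (1 / (p / (p - 1)))) < \<infinity>)}"

text \<open>
  $A_{p(\cdot),q(\cdot)}$ for exponents with $1/p(x) - 1/q(x) = \gamma$; the parameter \<open>\<gamma>\<close> is
  that constant.
\<close>

definition A_var ::
  "real \<Rightarrow> ('a::euclidean_space \<Rightarrow> ennreal) \<Rightarrow> ('a \<Rightarrow> ennreal) \<Rightarrow> ('a \<Rightarrow> ennreal) set" where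
  "A_var \<gamma> p q = {w \<in> var_weights.
     (SUP B\<in>balls. emeasure lebesgue B epowr (\<gamma> - 1) *
        var_norm q (\<lambda>x. w x * indicator B x) *
        var_norm (\<lambda>x. conj_exp (p x)) (\<lambda>x. w x epowr (-1) * indicator B x)) < \<infinity>}"

text \<open>
  The inequality $L(f) \le C\,R(g)$ over $\mathcal{F}$: one constant $C$ serves all pairs
  $(f,g)\in\mathcal{F}$ with $L(f) < \infty$.
\<close>

definition family_ineq :: "('b \<times> 'b) set \<Rightarrow> ('b \<Rightarrow> ennreal) \<Rightarrow> ('b \<Rightarrow> ennreal) \<Rightarrow> bool" where
  "family_ineq F L R \<longleftrightarrow>
     (\<exists>C::real. C > 0 \<and> (\<forall>(f, g) \<in> F. L f < \<infinity> \<longrightarrow> L f \<le> ennreal C * R g))"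

end

theory Submission
  imports Defs
begin

text \<open>
  The proof constructs, from the pairs at hand, one constant-exponent weight for which the
  hypothesis implies the conclusion.  Put $\gamma = 1/p_0 - 1/q_0$, so that $1/\sigma = 1 - \gamma$, and
  write $r = q/\sigma$ and $v = w^\sigma$.

  Suppose that $\|fw\|_q$ is close to $1$ and $\|gw\|_p \le 1$.  The function $u$ with
  $uw = (gw)^{1-\gamma p}$ also has $\|uw\|_q$ bounded, since $q(1-\gamma p) = p$ (lemma
  \<open>unit_ball_transfer\<close>).  The iteration algorithm of Rubio de Francia for $M$ on $L^r(v)$ produces
  $H$ with $H \ge c f^\sigma$, $H \ge c u^\sigma$ and the $A_1$ property; duality supplies a function that
  norms $(fw)^\sigma$ in $L^r$ (lemma \<open>norming_function\<close>), and the algorithm on the dual space produces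
  from it a function $G$ with the $A_1$ property and $\int f^\sigma G \ge c$.  By Hoelder's inequality
  $\int HG \le 2$.  The weight is $w_0 = H^{1/p_0-1} G^{1/q_0}$, and it belongs to $A_{p_0,q_0}$ by the
  easy half of the factorisation theorem (lemma \<open>factored_weight_A_const\<close>).  For $p_0 = 1$ the
  function $H$ has exponent $0$ in $w_0$: it may be any majorant of $f^\sigma$ and $u^\sigma$, and the $A_1$
  property of $G$ gives the membership.

  Two pointwise identities finish the argument.  On the left-hand side, $f^{q_0} w_0^{q_0} = HG\, z^{q_0/\sigma}$
  with $z = f^\sigma/H$, while $f^\sigma G = HG\, z$.  As $z$ is bounded, the integral of the former is finite, and
  as the integral of $HG\, z$ is bounded below, so is the integral of $HG\, z^{q_0/\sigma}$.  On the right-hand side,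
  with $\theta = p_0/q_0$,
    $g^{p_0} w_0^{p_0} = ((gw)^p)^{1-\theta} (HG)^\theta (u^\sigma/H)^{p_0/\sigma}$,
  whose integral is bounded.  The variable exponents occur only inside the modulars and never as an
  exponent of a constant.

  The hypothesis provides a constant for each weight separately, with no uniformity over weights.
  The proof is therefore by contradiction: a sequence of pairs that violate the conclusion with
  rapidly growing constants is treated with one weight, obtained by applying the above to a
  geometric series of all the functions involved (lemmas \<open>unit_ball_majorant\<close> and
  \<open>extrapolation_weight\<close>).  The losses depend on the index only, and are absorbed in the choice of
  the growing constants.

  All norm estimates are phrased through the unit ball of the modular, which makes scaling and
  countable sums elementary.
\<close>

section \<open>Powers of extended non-negative numbers\<close>

lemma epowr_ennreal: "0 < x \<Longrightarrow> ennreal x epowr a = ennreal (x powr a)"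
  by (simp add: epowr_def)

lemma epowr_one [simp]: "x epowr 1 = x"
  by (cases x) (auto simp: epowr_def)

lemma epowr_exp_0 [simp]: "x epowr 0 = 1"
  by (simp add: epowr_def)

lemma one_epowr [simp]: "1 epowr a = 1"
  by (auto simp: epowr_def)

lemma zero_epowr: "0 < a \<Longrightarrow> 0 epowr a = 0"
  by (simp add: epowr_def)

lemma ennreal_pos_cases:
  fixes x :: ennreal
  obtains "x = 0" | "x = \<infinity>" | r where "x = ennreal r" "0 < r"
proof (cases x)
  case (real r)
  with that show ?thesis by (cases "r = 0") auto
qed (use that in auto)

lemma epowr_eq_0: "0 < a \<Longrightarrow> x epowr a = 0 \<longleftrightarrow> x = 0"
  by (cases x rule: ennreal_pos_cases) (auto simp: epowr_def)

lemma epowr_eq_top: "0 < a \<Longrightarrow> x epowr a = \<infinity> \<longleftrightarrow> x = \<infinity>"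
  by (cases x rule: ennreal_pos_cases) (auto simp: epowr_def)

lemma epowr_mono:
  assumes "0 \<le> a" "x \<le> y"
  shows "x epowr a \<le> y epowr a"
  using assms
  by (cases x rule: ennreal_pos_cases; cases y rule: ennreal_pos_cases)
     (auto simp: epowr_def powr_mono2 top_unique)

lemma epowr_mult:
  assumes "0 \<le> a"
  shows "(x * y) epowr a = x epowr a * y epowr a"
proof (cases "a = 0")
  case False
  with assms have "0 < a" by simp
  then show ?thesis
    by (cases x rule: ennreal_pos_cases; cases y rule: ennreal_pos_cases)
       (auto simp: zero_epowr epowr_ennreal powr_mult epowr_eq_top[THEN iffD2]
          ennreal_mult_top ennreal_top_mult simp flip: ennreal_mult ennreal_mult')
qed simp

lemma epowr_epowr: "(x epowr a) epowr b = x epowr (a * b)"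
proof (cases x rule: ennreal_pos_cases)
  case (3 r)
  then show ?thesis by (simp add: epowr_ennreal powr_powr)
qed (auto simp: epowr_def zero_less_mult_iff mult_less_0_iff)

lemma epowr_add:
  assumes "0 \<le> a" "0 \<le> b"
  shows "x epowr (a + b) = x epowr a * x epowr b"
proof (cases x rule: ennreal_pos_cases)
  case (3 r)
  then show ?thesis by (simp add: epowr_ennreal powr_add ennreal_mult)
qed (use assms in \<open>auto simp: epowr_def ennreal_top_mult\<close>)

text \<open>
  Convexity of powers with exponent at least $1$, for one factor $c \le 1$.  It replaces
  convexity of the modular everywhere below: scaling a function by $c$ shrinks its modular by at
  least the factor $c$.
\<close>
lemma epowr_cmult_le:
  assumes "0 \<le> c" "c \<le> 1" "1 \<le> a"
  shows "(ennreal c * y) epowr a \<le> ennreal c * y epowr a"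
proof -
  have "ennreal c epowr a \<le> ennreal c"
  proof (cases "c = 0")
    case False
    then show ?thesis
      using assms powr_mono'[of 1 a c] by (auto simp: epowr_ennreal)
  qed (use assms in \<open>simp add: zero_epowr\<close>)
  then show ?thesis
    using assms by (simp add: epowr_mult mult_right_mono)
qed

lemma epowr_le_self:
  assumes "x \<le> 1" "1 \<le> a"
  shows "x epowr a \<le> x"
proof -
  obtain c where c: "x = ennreal c" "0 \<le> c"
    using assms by (cases x) (auto simp: top_unique)
  with assms have "c \<le> 1" by simp
  then show ?thesis
    using epowr_cmult_le[of c a 1] assms c by simp
qed

lemma epowr_le_one: "x \<le> 1 \<Longrightarrow> 0 \<le> a \<Longrightarrow> x epowr a \<le> 1"
  using epowr_mono[of a x 1] by simp

lemma measurable_epowr [measurable]: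
  assumes [measurable]: "f \<in> borel_measurable M" "g \<in> borel_measurable M"
  shows "(\<lambda>x. f x epowr g x) \<in> borel_measurable M"
  unfolding epowr_def by measurable

section \<open>The unit ball of a variable Lebesgue space\<close>

definition fin_modular :: "('a::euclidean_space \<Rightarrow> ennreal) \<Rightarrow> ('a \<Rightarrow> ennreal) \<Rightarrow> ennreal" where
  "fin_modular p f = (\<integral>\<^sup>+x\<in>{x. p x \<noteq> \<infinity>}. f x epowr enn2real (p x) \<partial>lebesgue)"

text \<open>
  The functions whose modular is at most $1$.  The number \<open>s\<close> bounds the essential supremum over
  the set where $p = \infty$; an explicit bound keeps the almost-everywhere reasoning on the
  whole space instead of a restricted measure.
\<close>
definition unit_ball :: "('a::euclidean_space \<Rightarrow> ennreal) \<Rightarrow> ('a \<Rightarrow> ennreal) set" where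
  "unit_ball p = {f \<in> borel_measurable lebesgue.
     \<exists>s. (AE x in lebesgue. p x = \<infinity> \<longrightarrow> f x \<le> s) \<and> fin_modular p f + s \<le> 1}"

lemma unit_ballI:
  assumes "f \<in> borel_measurable lebesgue"
    and "AE x in lebesgue. p x = \<infinity> \<longrightarrow> f x \<le> s"
    and "fin_modular p f \<le> t" and "t + s \<le> 1"
  shows "f \<in> unit_ball p"
  unfolding unit_ball_def using assms(1,2) order.trans[OF add_right_mono[OF assms(3)] assms(4)] by blast

lemma unit_ballE:
  assumes "f \<in> unit_ball p"
  obtains s where "AE x in lebesgue. p x = \<infinity> \<longrightarrow> f x \<le> s" "fin_modular p f + s \<le> 1"
    "s \<le> 1" "fin_modular p f \<le> 1"
proof -
  obtain s where *: "AE x in lebesgue. p x = \<infinity> \<longrightarrow> f x \<le> s" "fin_modular p f + s \<le> 1"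
    using assms by (auto simp: unit_ball_def)
  have "s \<le> fin_modular p f + s" "fin_modular p f \<le> fin_modular p f + s"
    by (simp_all add: add_increasing add_increasing2)
  then have "s \<le> 1" "fin_modular p f \<le> 1"
    using *(2) order.trans by blast+
  then show ?thesis using * that by blast
qed

lemma unit_ball_measurable [measurable_dest]:
  "f \<in> unit_ball p \<Longrightarrow> f \<in> borel_measurable lebesgue"
  by (simp add: unit_ball_def)

lemma exponents_measurable [measurable_dest]:
  "p \<in> exponents \<Longrightarrow> p \<in> borel_measurable lebesgue"
  by (simp add: exponents_def)

lemma sets_infinite_exponent:
  assumes [measurable]: "p \<in> borel_measurable lebesgue"
  shows "{x. p x = (\<infinity>::ennreal)} \<in> sets lebesgue"
proof -
  have "{x \<in> space lebesgue. p x = \<infinity>} \<in> sets lebesgue" by measurable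
  then show ?thesis by simp
qed

lemma exponents_ge_1: "p \<in> exponents \<Longrightarrow> 1 \<le> p x"
  by (simp add: exponents_def)

lemma exponents_enn2real: "p \<in> exponents \<Longrightarrow> p x \<noteq> \<infinity> \<Longrightarrow> 1 \<le> enn2real (p x)"
  using exponents_ge_1[of p x] enn2real_mono[of 1 "p x"] by (simp add: less_top)

lemma fin_modular_mono:
  assumes "AE x in lebesgue. p x \<noteq> \<infinity> \<longrightarrow> g x \<le> f x"
  shows "fin_modular p g \<le> fin_modular p f"
  unfolding fin_modular_def
proof (rule nn_integral_mono_AE)
  show "AE x in lebesgue. g x epowr enn2real (p x) * indicator {x. p x \<noteq> \<infinity>} x
      \<le> f x epowr enn2real (p x) * indicator {x. p x \<noteq> \<infinity>} x"
    using assms by eventually_elim (auto simp: indicator_def intro: epowr_mono)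
qed

lemma unit_ball_mono:
  assumes "f \<in> unit_ball p" "AE x in lebesgue. g x \<le> f x" "g \<in> borel_measurable lebesgue"
  shows "g \<in> unit_ball p"
proof -
  obtain s where s: "AE x in lebesgue. p x = \<infinity> \<longrightarrow> f x \<le> s" "fin_modular p f + s \<le> 1"
    "s \<le> 1" "fin_modular p f \<le> 1"
    by (rule unit_ballE[OF assms(1)])
  show ?thesis
  proof (rule unit_ballI[OF assms(3) _ _ s(2)])
    show "AE x in lebesgue. p x = \<infinity> \<longrightarrow> g x \<le> s"
      using s(1) assms(2) by eventually_elim auto
    show "fin_modular p g \<le> fin_modular p f"
      using assms(2) by (intro fin_modular_mono) (auto elim: eventually_mono)
  qed
qed

lemma unit_ball_finite:
  assumes f: "f \<in> unit_ball p" and p: "p \<in> exponents"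
  shows "AE x in lebesgue. f x < \<infinity>"
proof -
  note [measurable] = unit_ball_measurable[OF f] exponents_measurable[OF p]
  obtain s where s: "AE x in lebesgue. p x = \<infinity> \<longrightarrow> f x \<le> s" "fin_modular p f + s \<le> 1"
    "s \<le> 1" "fin_modular p f \<le> 1"
    by (rule unit_ballE[OF f])
  have "AE x in lebesgue. f x epowr enn2real (p x) * indicator {x. p x \<noteq> \<infinity>} x \<noteq> \<infinity>"
    by (rule nn_integral_PInf_AE) (use s(4) in \<open>auto simp: top_unique fin_modular_def\<close>)
  with s(1) show ?thesis
  proof eventually_elim
    case (elim x)
    show ?case
    proof (cases "p x = \<infinity>")
      case True
      then have "f x \<le> 1" using elim s(3) by (auto intro: order.trans)
      then show ?thesis using le_less_trans[OF _ ennreal_one_less_top] by simp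
    next
      case False
      then show ?thesis
        using elim exponents_enn2real[OF p False] epowr_eq_top[of "enn2real (p x)" "f x"]
        by (auto simp: less_top)
    qed
  qed
qed

text \<open>
  This lemma and the next one translate between the norm and the unit ball.  The converse direction
  is stated for norms strictly below $l$, so that it does not depend on whether the infimum is
  attained.
\<close>
lemma var_norm_le:
  assumes "(\<lambda>x. ennreal (1 / l) * f x) \<in> unit_ball p" "0 < l" "p \<in> exponents"
    and [measurable]: "f \<in> borel_measurable lebesgue"
  shows "var_norm p f \<le> ennreal l"
proof -
  note [measurable] = exponents_measurable[OF assms(3)]
  have div: "f x / ennreal l = ennreal (1 / l) * f x" for x
    using assms(2) by (simp add: divide_ennreal_def inverse_ennreal mult.commute inverse_eq_divide)
  obtain s where s: "AE x in lebesgue. p x = \<infinity> \<longrightarrow> ennreal (1 / l) * f x \<le> s"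
    "fin_modular p (\<lambda>x. ennreal (1 / l) * f x) + s \<le> 1"
    "s \<le> 1" "fin_modular p (\<lambda>x. ennreal (1 / l) * f x) \<le> 1"
    by (rule unit_ballE[OF assms(1)])
  have l: "ennreal l * ennreal (1 / l) = 1"
    using assms(2) by (simp flip: ennreal_mult)
  have "AE x in lebesgue. p x = \<infinity> \<longrightarrow> f x \<le> ennreal l * s"
    using s(1)
  proof eventually_elim
    case (elim x)
    then show ?case
      using mult_left_mono[of "ennreal (1 / l) * f x" s "ennreal l"] l
      by (simp add: mult.assoc[symmetric])
  qed
  then have "esssup (restrict_space lebesgue {x. p x = \<infinity>}) f \<le> ennreal l * s"
    using sets_infinite_exponent[OF exponents_measurable[OF assms(3)]]
    by (intro esssup_I) (simp_all add: AE_restrict_space_iff measurable_restrict_space1)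
  then have "esssup (restrict_space lebesgue {x. p x = \<infinity>}) f / ennreal l \<le> ennreal l * s / ennreal l"
    by (rule divide_right_mono_ennreal)
  also have "\<dots> = s"
    using assms(2) by (metis ennreal_eq_0_iff ennreal_less_top ennreal_mult_divide_eq linorder_not_less mult.commute less_irrefl)
  finally have "(\<integral>\<^sup>+x\<in>{x. p x \<noteq> \<infinity>}. (f x / ennreal l) epowr enn2real (p x) \<partial>lebesgue)
      + esssup (restrict_space lebesgue {x. p x = \<infinity>}) f / ennreal l \<le> 1"
    unfolding div by (rule order.trans[OF add_left_mono s(2)[unfolded fin_modular_def]])
  then show ?thesis
    unfolding var_norm_def by (intro INF_lower) (use assms(2) in auto)
qed

lemma var_norm_less:
  assumes "var_norm p f < ennreal l" "p \<in> exponents"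
    and [measurable]: "f \<in> borel_measurable lebesgue"
  shows "(\<lambda>x. ennreal (1 / l) * f x) \<in> unit_ball p"
proof -
  note [measurable] = exponents_measurable[OF assms(2)]
  let ?R = "restrict_space lebesgue {x. p x = \<infinity>}"
  obtain m where m: "0 < m" "ennreal m < ennreal l"
    and 1: "(\<integral>\<^sup>+x\<in>{x. p x \<noteq> \<infinity>}. (f x / ennreal m) epowr enn2real (p x) \<partial>lebesgue)
          + esssup ?R f / ennreal m \<le> 1"
    using assms(1) unfolding var_norm_def by (auto simp: INF_less_iff)
  have div: "f x / ennreal m = ennreal (1 / m) * f x" for x
    using m by (simp add: divide_ennreal_def inverse_ennreal mult.commute inverse_eq_divide)
  have "AE x in lebesgue. p x = \<infinity> \<longrightarrow> f x \<le> esssup ?R f"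
    using esssup_AE[of f ?R] sets_infinite_exponent[OF exponents_measurable[OF assms(2)]]
    by (simp add: AE_restrict_space_iff)
  then have 2: "AE x in lebesgue. p x = \<infinity> \<longrightarrow> f x / ennreal m \<le> esssup ?R f / ennreal m"
    by eventually_elim (auto intro: divide_right_mono_ennreal)
  have "(\<lambda>x. f x / ennreal m) \<in> unit_ball p"
    by (rule unit_ballI[OF _ 2 order.refl 1[folded fin_modular_def]]) measurable
  then have *: "(\<lambda>x. ennreal (1 / m) * f x) \<in> unit_ball p"
    by (simp add: div)
  have "m < l" using m by (simp add: ennreal_less_iff)
  then show ?thesis
    using m by (intro unit_ball_mono[OF *]) (auto intro!: AE_I2 mult_right_mono simp: frac_le)
qed

lemma ennreal_le_suminf: "f i \<le> (\<Sum>i. f i :: ennreal)"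
  using sum_le_suminf[OF summableI, of "{i}" f] by simp

lemma suminf_half: "(\<Sum>k. ennreal ((1 / 2) ^ Suc k)) = 1"
proof -
  have "(\<Sum>k. ennreal ((1 / 2) ^ Suc k)) = ennreal 1"
    by (rule suminf_ennreal_eq[OF _ power_half_series]) (rule zero_le_power, simp)
  then show ?thesis by (simp only: ennreal_1)
qed

text \<open>
  Countable quasi-convexity of the unit ball.  Splitting $4^{-k-1} = 2^{-k-1} 2^{-k-1}$ bounds
  the series by the supremum of the functions $2^{-k-1} a_k$.  A power of a supremum is at most
  the sum of the powers, so the modular of that supremum is at most
  $\sum_k 2^{-k-1} = 1$.
\<close>
lemma unit_ball_suminf:
  assumes p: "p \<in> exponents" and a: "\<And>k. a k \<in> unit_ball p"
  shows "(\<lambda>x. \<Sum>k. ennreal ((1 / 4) ^ Suc k) * a k x) \<in> unit_ball p"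
proof -
  note [measurable] = exponents_measurable[OF p] unit_ball_measurable[OF a]
  define c where "c = (\<lambda>k. (1 / 2 :: real) ^ Suc k)"
  have c: "0 \<le> c k" "c k \<le> 1" for k
    by (simp_all add: c_def power_le_one del: power_Suc)
  define T where "T = (\<lambda>x. SUP k. ennreal (c k) * a k x)"
  have [measurable]: "T \<in> borel_measurable lebesgue"
    unfolding T_def by measurable
  have "\<forall>k. \<exists>s. (AE x in lebesgue. p x = \<infinity> \<longrightarrow> a k x \<le> s) \<and> fin_modular p (a k) + s \<le> 1"
  proof
    fix k
    obtain s where "AE x in lebesgue. p x = \<infinity> \<longrightarrow> a k x \<le> s" "fin_modular p (a k) + s \<le> 1"
      "s \<le> 1" "fin_modular p (a k) \<le> 1"
      by (rule unit_ballE[OF a])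
    then show "\<exists>s. (AE x in lebesgue. p x = \<infinity> \<longrightarrow> a k x \<le> s) \<and> fin_modular p (a k) + s \<le> 1"
      by blast
  qed
  then obtain s where s: "\<And>k. AE x in lebesgue. p x = \<infinity> \<longrightarrow> a k x \<le> s k"
      "\<And>k. fin_modular p (a k) + s k \<le> 1"
    by metis
  have "T \<in> unit_ball p"
  proof (rule unit_ballI)
    have "AE x in lebesgue. \<forall>k. p x = \<infinity> \<longrightarrow> a k x \<le> s k"
      unfolding AE_all_countable using s(1) by blast
    then show "AE x in lebesgue. p x = \<infinity> \<longrightarrow> T x \<le> (\<Sum>k. ennreal (c k) * s k)"
    proof eventually_elim
      case (elim x)
      show ?case
      proof
        assume "p x = \<infinity>"
        then have "ennreal (c k) * a k x \<le> ennreal (c k) * s k" for k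
          using elim by (simp add: mult_left_mono)
        then show "T x \<le> (\<Sum>k. ennreal (c k) * s k)"
          unfolding T_def
          by (intro SUP_least order.trans[OF _ ennreal_le_suminf[of "\<lambda>k. ennreal (c k) * s k"]])
      qed
    qed
    have ptw: "T x epowr enn2real (p x) \<le> (\<Sum>k. ennreal (c k) * a k x epowr enn2real (p x))" (is "_ \<le> ?Y")
      if "p x \<noteq> \<infinity>" for x
    proof -
      let ?P = "enn2real (p x)"
      have P: "1 \<le> ?P" by (rule exponents_enn2real[OF p that])
      have "ennreal (c k) * a k x \<le> ?Y epowr (1 / ?P)" for k
      proof -
        have "(ennreal (c k) * a k x) epowr ?P \<le> ennreal (c k) * a k x epowr ?P"
          by (rule epowr_cmult_le[OF c P])
        also have "\<dots> \<le> ?Y"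
          by (rule ennreal_le_suminf[of "\<lambda>k. ennreal (c k) * a k x epowr ?P"])
        finally have "((ennreal (c k) * a k x) epowr ?P) epowr (1 / ?P) \<le> ?Y epowr (1 / ?P)"
          using P by (intro epowr_mono) auto
        then show ?thesis using P by (simp add: epowr_epowr)
      qed
      then have "T x \<le> ?Y epowr (1 / ?P)"
        unfolding T_def by (rule SUP_least)
      then have "T x epowr ?P \<le> (?Y epowr (1 / ?P)) epowr ?P"
        using P by (intro epowr_mono) auto
      then show ?thesis using P by (simp add: epowr_epowr)
    qed
    have "fin_modular p T \<le> (\<integral>\<^sup>+x. (\<Sum>k. ennreal (c k) * (a k x epowr enn2real (p x) * indicator {x. p x \<noteq> \<infinity>} x)) \<partial>lebesgue)"
      unfolding fin_modular_def
      by (intro nn_integral_mono) (auto simp: indicator_def ptw)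
    also have "\<dots> = (\<Sum>k. ennreal (c k) * fin_modular p (a k))"
      unfolding fin_modular_def
      by (subst nn_integral_suminf) (auto simp: nn_integral_cmult)
    finally show "fin_modular p T \<le> (\<Sum>k. ennreal (c k) * fin_modular p (a k))" .
    have "(\<Sum>k. ennreal (c k) * fin_modular p (a k)) + (\<Sum>k. ennreal (c k) * s k)
        = (\<Sum>k. ennreal (c k) * (fin_modular p (a k) + s k))"
      by (subst suminf_add) (auto simp: distrib_left)
    also have "\<dots> \<le> (\<Sum>k. ennreal (c k))"
    proof (intro suminf_le summableI)
      fix k show "ennreal (c k) * (fin_modular p (a k) + s k) \<le> ennreal (c k)"
        using mult_left_mono[OF s(2)[of k], of "ennreal (c k)"] by simp
    qed
    also have "\<dots> = 1" unfolding c_def by (rule suminf_half)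
    finally show "(\<Sum>k. ennreal (c k) * fin_modular p (a k)) + (\<Sum>k. ennreal (c k) * s k) \<le> 1" .
  qed measurable
  then show ?thesis
  proof (rule unit_ball_mono)
    have "(\<Sum>k. ennreal ((1 / 4) ^ Suc k) * a k x) \<le> T x" for x
    proof -
      have "(\<Sum>k. ennreal ((1 / 4) ^ Suc k) * a k x) \<le> (\<Sum>k. ennreal (c k) * T x)"
      proof (intro suminf_le summableI)
        fix k
        have "(1 / 4 :: real) ^ Suc k = c k * c k"
          unfolding c_def by (simp flip: power_mult_distrib)
        then have "ennreal ((1 / 4) ^ Suc k) * a k x = ennreal (c k) * (ennreal (c k) * a k x)"
          using c by (simp add: ennreal_mult mult.assoc)
        also have "\<dots> \<le> ennreal (c k) * T x"
          unfolding T_def by (intro mult_left_mono SUP_upper) auto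
        finally show "ennreal ((1 / 4) ^ Suc k) * a k x \<le> ennreal (c k) * T x" .
      qed
      also have "\<dots> = T x"
        unfolding c_def by (simp only: ennreal_suminf_multc suminf_half mult_1)
      finally show ?thesis .
    qed
    then show "AE x in lebesgue. (\<Sum>k. ennreal ((1 / 4) ^ Suc k) * a k x) \<le> T x"
      by simp
  qed measurable
qed

text \<open>
  Powers with exponent at least $1$ do not increase numbers below $1$, so a function with values
  and integral at most $1/2$ lies in the unit ball, whatever the exponent.  Such positive functions
  exist because Lebesgue measure is $\sigma$-finite.
\<close>
lemma positive_in_unit_ball:
  assumes p: "p \<in> exponents"
  obtains e where "e \<in> unit_ball p" "\<And>x. 0 < e x"
proof -
  obtain h :: "'a \<Rightarrow> ennreal" where h: "h \<in> borel_measurable lborel"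
    "integral\<^sup>N lborel h \<noteq> \<infinity>" "\<And>x. 0 < h x"
    using sigma_finite_measure.Ex_finite_integrable_function[OF sigma_finite_lborel] by auto
  note [measurable] = exponents_measurable[OF p]
  have [measurable]: "h \<in> borel_measurable lebesgue"
    using h(1) by (rule measurable_completion)
  have fin: "integral\<^sup>N lebesgue h < \<infinity>"
    using h by (simp add: nn_integral_completion less_top)
  define m where "m = 1 + enn2real (integral\<^sup>N lebesgue h)"
  have m: "1 \<le> m" "integral\<^sup>N lebesgue h \<le> ennreal m"
    using fin ennreal_leI[of "enn2real (integral\<^sup>N lebesgue h)" m] by (simp_all add: m_def)
  define g where "g = (\<lambda>x. min 1 (ennreal (1 / m) * h x))"
  have [measurable]: "g \<in> borel_measurable lebesgue"
    unfolding g_def by measurable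
  have g: "g x \<le> 1" "0 < g x" for x
    using m h(3)[of x] by (auto simp: g_def ennreal_zero_less_mult_iff)
  have half: "ennreal (1 / 2) + ennreal (1 / 2) = 1"
  proof -
    have "ennreal (1 / 2) + ennreal (1 / 2) = ennreal (1 / 2 + 1 / 2)"
      by (rule ennreal_plus[symmetric]) simp_all
    also have "1 / 2 + 1 / 2 = (1 :: real)" by simp
    finally show ?thesis by (simp only: ennreal_1)
  qed
  have "integral\<^sup>N lebesgue g \<le> ennreal (1 / m) * integral\<^sup>N lebesgue h"
    by (subst nn_integral_cmult[symmetric]) (auto simp: g_def intro!: nn_integral_mono)
  also have "\<dots> \<le> ennreal (1 / m) * ennreal m"
    by (intro mult_left_mono m) auto
  also have "\<dots> = 1" using m by (simp flip: ennreal_mult)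
  finally have int_g: "integral\<^sup>N lebesgue g \<le> 1" .
  have "(\<lambda>x. ennreal (1 / 2) * g x) \<in> unit_ball p"
  proof (rule unit_ballI[OF _ _ _ half[THEN eq_refl]])
    have le: "ennreal (1 / 2) * g x \<le> ennreal (1 / 2)" for x
      using mult_left_mono[OF g(1)[of x], of "ennreal (1 / 2)"] by simp
    then show "AE x in lebesgue. p x = \<infinity> \<longrightarrow> ennreal (1 / 2) * g x \<le> ennreal (1 / 2)"
      by simp
    have "fin_modular p (\<lambda>x. ennreal (1 / 2) * g x) \<le> (\<integral>\<^sup>+x. ennreal (1 / 2) * g x \<partial>lebesgue)"
      unfolding fin_modular_def
    proof (intro nn_integral_mono)
      fix x
      have "ennreal (1 / 2) \<le> ennreal 1" by (rule ennreal_leI) simp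
      then have "ennreal (1 / 2) * g x \<le> 1"
        using order.trans[OF le[of x]] by (simp only: ennreal_1)
      then show "(ennreal (1 / 2) * g x) epowr enn2real (p x) * indicator {x. p x \<noteq> \<infinity>} x
          \<le> ennreal (1 / 2) * g x"
        using epowr_le_self exponents_enn2real[OF p] by (auto simp: indicator_def)
    qed
    also have "\<dots> \<le> ennreal (1 / 2)"
      using mult_left_mono[OF int_g, of "ennreal (1 / 2)"] by (simp add: nn_integral_cmult)
    finally show "fin_modular p (\<lambda>x. ennreal (1 / 2) * g x) \<le> ennreal (1 / 2)" .
  qed measurable
  then show thesis
  proof (rule that)
    have "0 < ennreal (1 / 2)" by (subst ennreal_less_zero_iff) simp
    then show "0 < ennreal (1 / 2) * g x" for x
      using g(2)[of x] by (subst ennreal_zero_less_mult_iff) blast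
  qed
qed

text \<open>
  One function of the unit ball dominates all members of a sequence, up to constants that depend
  only on the index.  This is what allows a single weight to serve infinitely many pairs.  A positive
  function is put in front of the sequence so that \<open>S\<close> vanishes nowhere.
\<close>
lemma unit_ball_majorant:
  assumes p: "p \<in> exponents" and a: "\<And>k. a k \<in> unit_ball p"
  obtains S where "S \<in> unit_ball p" "\<And>x. 0 < S x"
    "\<And>k x. a k x \<le> ennreal (4 ^ (k + 2)) * S x"
proof -
  obtain e where e: "e \<in> unit_ball p" "\<And>x. 0 < e x"
    by (rule positive_in_unit_ball[OF p]) blast
  define b where "b = case_nat e a"
  define S where "S = (\<lambda>x. \<Sum>k. ennreal ((1 / 4) ^ Suc k) * b k x)"
  have S_ge: "ennreal ((1 / 4) ^ Suc k) * b k x \<le> S x" for k x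
    unfolding S_def by (rule ennreal_le_suminf[of "\<lambda>k. ennreal ((1 / 4) ^ Suc k) * b k x"])
  show thesis
  proof (rule that[of S])
    show "S \<in> unit_ball p"
      unfolding S_def by (intro unit_ball_suminf[OF p]) (auto simp: b_def e a split: nat.split)
    show "0 < S x" for x
      using e(2)[of x] by (intro less_le_trans[OF _ S_ge[of 0]]) (simp add: b_def ennreal_zero_less_mult_iff)
    show "a k x \<le> ennreal (4 ^ (k + 2)) * S x" for k x
    proof -
      have "a k x = ennreal (4 ^ (k + 2)) * (ennreal ((1 / 4) ^ Suc (Suc k)) * a k x)"
        by (simp add: mult.assoc[symmetric] power_divide flip: ennreal_mult)
      also have "\<dots> \<le> ennreal (4 ^ (k + 2)) * S x"
        using S_ge[of "Suc k" x] by (intro mult_left_mono) (simp_all add: b_def)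
      finally show ?thesis .
    qed
  qed
qed

section \<open>Duality\<close>

lemma conj_exp_cases:
  assumes "1 \<le> r"
  obtains "r = \<infinity>" "conj_exp r = 1"
  | "r = 1" "conj_exp r = \<infinity>"
  | t where "r = ennreal t" "1 < t" "conj_exp r = ennreal (t / (t - 1))"
proof (cases r)
  case top
  then show ?thesis using that(1) by (simp add: conj_exp_def)
next
  case (real t)
  show ?thesis
  proof (cases "t = 1")
    case True
    then show ?thesis using real that(2) by (simp add: conj_exp_def)
  next
    case False
    with real assms have t: "1 < t" by simp
    have "1 / r + 1 / ennreal (t / (t - 1)) = ennreal (1 / t + (t - 1) / t)"
      using t real by (simp add: divide_ennreal flip: ennreal_1 del: ennreal_1)
    also have "1 / t + (t - 1) / t = 1"
      using t by (simp add: field_simps)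
    finally have "ennreal (t / (t - 1)) = conj_exp r"
      by (intro conj_exp_unique) simp
    then show ?thesis using that(3)[of t] t real by simp
  qed
qed

lemma conj_exp_exponents:
  assumes "r \<in> exponents"
  shows "(\<lambda>x. conj_exp (r x)) \<in> exponents"
proof -
  note [measurable] = exponents_measurable[OF assms]
  have "1 \<le> conj_exp (r x)" for x
    by (rule conj_exp_cases[OF exponents_ge_1[OF assms, of x]])
       (auto simp: field_simps simp flip: ennreal_1 intro!: ennreal_leI)
  then show ?thesis
    unfolding exponents_def conj_exp_def by simp
qed

text \<open>
  Young's inequality without the optimal constants: compare $z$ with $y^{t-1}$, and replace
  the smaller of the two factors.
\<close>
lemma Young_cases:
  fixes y z :: ennreal
  assumes "1 < t"
  shows "y * z \<le> y epowr t + z epowr (t / (t - 1))"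
proof (cases "z \<le> y epowr (t - 1)")
  case True
  then have "y * z \<le> y epowr 1 * y epowr (t - 1)"
    by (simp add: mult_left_mono)
  also have "\<dots> = y epowr t"
    using assms by (subst epowr_add[symmetric]) auto
  finally show ?thesis
    by (rule order.trans) simp
next
  case False
  then have "y epowr (t - 1) \<le> z" by simp
  then have "(y epowr (t - 1)) epowr (1 / (t - 1)) \<le> z epowr (1 / (t - 1))"
    using assms by (intro epowr_mono) auto
  then have "y \<le> z epowr (1 / (t - 1))"
    using assms by (simp add: epowr_epowr)
  then have "y * z \<le> z epowr (1 / (t - 1)) * z epowr 1"
    by (simp add: mult_right_mono)
  also have "\<dots> = z epowr (1 / (t - 1) + 1)"
    using assms by (subst epowr_add[symmetric]) auto
  also have "1 / (t - 1) + 1 = t / (t - 1)"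
    using assms by (simp add: field_simps)
  finally show ?thesis
    by (rule order.trans) simp
qed

lemma Holder_unit_ball:
  assumes r: "r \<in> exponents" and f: "f \<in> unit_ball r" and g: "g \<in> unit_ball (\<lambda>x. conj_exp (r x))"
  shows "(\<integral>\<^sup>+x. f x * g x \<partial>lebesgue) \<le> 2"
proof -
  note [measurable] = exponents_measurable[OF r] exponents_measurable[OF conj_exp_exponents[OF r]]
    unit_ball_measurable[OF f] unit_ball_measurable[OF g]
  let ?r' = "\<lambda>x. conj_exp (r x)"
  obtain s where s: "AE x in lebesgue. r x = \<infinity> \<longrightarrow> f x \<le> s" "fin_modular r f + s \<le> 1"
    "s \<le> 1" "fin_modular r f \<le> 1"
    by (rule unit_ballE[OF f])
  obtain t where t: "AE x in lebesgue. ?r' x = \<infinity> \<longrightarrow> g x \<le> t" "fin_modular ?r' g + t \<le> 1"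
    "t \<le> 1" "fin_modular ?r' g \<le> 1"
    by (rule unit_ballE[OF g])
  let ?A = "\<lambda>x. f x epowr enn2real (r x) * indicator {x. r x \<noteq> \<infinity>} x"
  let ?B = "\<lambda>x. g x epowr enn2real (?r' x) * indicator {x. ?r' x \<noteq> \<infinity>} x"
  have "AE x in lebesgue. f x * g x \<le> ?A x + ?B x"
    using s(1) t(1)
  proof eventually_elim
    case (elim x)
    show ?case
    proof (rule conj_exp_cases[OF exponents_ge_1[OF r, of x]])
      assume *: "r x = \<infinity>" "?r' x = 1"
      then have "f x \<le> 1" using elim order.trans[OF _ s(3)] by simp
      then show ?thesis using * mult_right_mono[of "f x" 1 "g x"] by simp
    next
      assume *: "r x = 1" "?r' x = \<infinity>"
      then have "g x \<le> 1" using elim order.trans[OF _ t(3)] by simp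
      then show ?thesis using * mult_left_mono[of "g x" 1 "f x"] by simp
    next
      fix u assume *: "r x = ennreal u" "1 < u" "?r' x = ennreal (u / (u - 1))"
      then show ?thesis using Young_cases[of u "f x" "g x"] by simp
    qed
  qed
  then have "(\<integral>\<^sup>+x. f x * g x \<partial>lebesgue) \<le> (\<integral>\<^sup>+x. ?A x + ?B x \<partial>lebesgue)"
    by (rule nn_integral_mono_AE)
  also have "\<dots> = fin_modular r f + fin_modular ?r' g"
    unfolding fin_modular_def by (rule nn_integral_add) measurable
  also have "\<dots> \<le> 1 + 1" by (intro add_mono s t)
  finally show ?thesis by simp
qed

text \<open>
  Cut off to bounded values and to a ball, and apply monotone convergence.
\<close>
lemma finite_part_of_integral:
  fixes h :: "'a::euclidean_space \<Rightarrow> ennreal"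
  assumes [measurable]: "h \<in> borel_measurable lebesgue"
    and fin: "AE x in lebesgue. h x < \<infinity>" and c: "c < integral\<^sup>N lebesgue h"
  obtains D where "D \<in> sets lebesgue" "c < (\<integral>\<^sup>+x\<in>D. h x \<partial>lebesgue)" "(\<integral>\<^sup>+x\<in>D. h x \<partial>lebesgue) < \<infinity>"
proof -
  define D where "D = (\<lambda>n::nat. {x. h x \<le> of_nat n} \<inter> cball 0 (real n))"
  have [measurable]: "D n \<in> sets lebesgue" for n
  proof -
    have "{x \<in> space lebesgue. h x \<le> of_nat n} \<in> sets lebesgue" by measurable
    then show ?thesis unfolding D_def by auto
  qed
  have mono: "D m \<subseteq> D n" if "m \<le> n" for m n
    using that unfolding D_def
    by (auto intro: order.trans[of _ "of_nat m" "of_nat n"] simp: of_nat_mono)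
  have SUP: "AE x in lebesgue. (SUP n. h x * indicator (D n) x) = h x"
    using fin
  proof eventually_elim
    case (elim x)
    then obtain t where t: "h x = ennreal t" "0 \<le> t" by (cases "h x") auto
    obtain n where n: "max t (norm x) \<le> real n" using real_arch_simple by blast
    then have "h x \<le> of_nat n"
      using t by (simp add: ennreal_of_nat_eq_real_of_nat ennreal_leI)
    then have "x \<in> D n" using n by (simp add: D_def)
    then have "h x \<le> (SUP n. h x * indicator (D n) x)"
      by (intro SUP_upper2[of n]) auto
    moreover have "(SUP n. h x * indicator (D n) x) \<le> h x"
      by (intro SUP_least) (auto simp: indicator_def)
    ultimately show ?case by simp
  qed
  have "integral\<^sup>N lebesgue h = (\<integral>\<^sup>+x. (SUP n. h x * indicator (D n) x) \<partial>lebesgue)"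
    using SUP by (intro nn_integral_cong_AE) (auto elim: eventually_mono)
  also have "\<dots> = (SUP n. \<integral>\<^sup>+x\<in>D n. h x \<partial>lebesgue)"
  proof (rule nn_integral_monotone_convergence_SUP)
    show "incseq (\<lambda>n x. h x * indicator (D n) x)"
      using mono[OF le_SucI[OF order.refl]] by (intro incseq_SucI le_funI) (auto simp: indicator_def)
  qed measurable
  finally obtain n where n: "c < (\<integral>\<^sup>+x\<in>D n. h x \<partial>lebesgue)"
    using c by (auto simp: less_SUP_iff)
  have "(\<integral>\<^sup>+x\<in>D n. h x \<partial>lebesgue) \<le> (\<integral>\<^sup>+x. of_nat n * indicator (cball (0::'a) (real n)) x \<partial>lebesgue)"
    by (intro nn_integral_mono) (auto simp: D_def indicator_def)
  also have "\<dots> = of_nat n * emeasure lebesgue (cball (0::'a) (real n))"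
    by (subst nn_integral_cmult_indicator) auto
  also have "\<dots> < \<infinity>"
    using emeasure_lborel_cball_finite[of "0::'a" "real n"]
    by (simp add: ennreal_mult_less_top of_nat_less_top)
  finally show thesis using n by (intro that[of "D n"]) auto
qed

text \<open>
  If the modular exceeds $1$, one of its two parts exceeds $1/2$.  If it is the integral, then
  $f^{r-1}$, restricted to a set where the integral of $f^r$ is finite and scaled down when that
  integral exceeds $1$, norms $f$, because $(r-1) r' = r$.  If it is the supremum, a normalised
  indicator function does.
\<close>
lemma norming_function:
  fixes f :: "'a::euclidean_space \<Rightarrow> ennreal"
  assumes r: "r \<in> exponents" and f[measurable]: "f \<in> borel_measurable lebesgue"
    and fin: "AE x in lebesgue. f x < \<infinity>" and not_unit: "f \<notin> unit_ball r"
  obtains b where "b \<in> unit_ball (\<lambda>x. conj_exp (r x))"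
    "ennreal (1 / 4) \<le> (\<integral>\<^sup>+x. f x * b x \<partial>lebesgue)"
proof -
  note [measurable] = exponents_measurable[OF r] exponents_measurable[OF conj_exp_exponents[OF r]]
  let ?r' = "\<lambda>x. conj_exp (r x)"
  have half: "ennreal (1 / 2) + ennreal (1 / 2) \<le> 1"
    by (subst ennreal_plus[symmetric]) simp_all
  have [measurable]: "{x. r x = \<infinity>} \<in> sets lebesgue" "{x. r x \<noteq> \<infinity>} \<in> sets lebesgue"
    using sets_infinite_exponent[OF exponents_measurable[OF r]]
      sets.compl_sets[OF sets_infinite_exponent[OF exponents_measurable[OF r]]]
    by (auto simp: Compl_eq_Diff_UNIV[symmetric] Collect_neg_eq)
  consider (fin) "ennreal (1 / 2) < fin_modular r f"
    | (inf) "\<not> (AE x in lebesgue. r x = \<infinity> \<longrightarrow> f x \<le> ennreal (1 / 2))"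
    using unit_ballI[OF f _ _ half, of r] not_unit by (meson not_le)
  then show thesis
  proof cases
    case fin
    let ?h = "\<lambda>x. f x epowr enn2real (r x) * indicator {x. r x \<noteq> \<infinity>} x"
    have "AE x in lebesgue. ?h x < \<infinity>"
      using \<open>AE x in lebesgue. f x < \<infinity>\<close>
    proof eventually_elim
      case (elim x)
      then show ?case
        using exponents_enn2real[OF r, of x] epowr_eq_top[of "enn2real (r x)" "f x"]
        by (auto simp: indicator_def less_top)
    qed
    then obtain D where [measurable]: "D \<in> sets lebesgue"
      and D: "ennreal (1 / 2) < (\<integral>\<^sup>+x\<in>D. ?h x \<partial>lebesgue)" "(\<integral>\<^sup>+x\<in>D. ?h x \<partial>lebesgue) < \<infinity>"
      using finite_part_of_integral[of ?h "ennreal (1 / 2)"] fin[unfolded fin_modular_def] by auto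
    then obtain m where m: "(\<integral>\<^sup>+x\<in>D. ?h x \<partial>lebesgue) = ennreal m" "1 / 2 < m"
      by (cases "\<integral>\<^sup>+x\<in>D. ?h x \<partial>lebesgue") (auto simp: ennreal_less_iff simp del: ennreal_half)
    \<comment> \<open>If \<open>m > 1\<close> the integral is normalised to 1, otherwise it is already between 1/2 and 1.  The final
      halving makes room for the supremum part, which is present where \<open>r = 1\<close>.\<close>
    define t where "t = (if m \<le> 1 then 1 else 1 / m) / 2"
    have t: "0 \<le> t" "t \<le> 1 / 2" "t * m \<le> 1 / 2" "1 / 4 \<le> t * m"
      using m by (auto simp: t_def field_simps)
    define b where "b = (\<lambda>x. ennreal t * (f x epowr (enn2real (r x) - 1) * (indicator {x. r x \<noteq> \<infinity>} x * indicator D x)))"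
    have [measurable]: "b \<in> borel_measurable lebesgue" unfolding b_def by measurable
    have b1: "b x \<le> ennreal (1 / 2)" if "r x = 1" for x
      using that t by (auto simp: b_def indicator_def intro!: ennreal_leI simp del: ennreal_half)
    have b2: "b x epowr enn2real (?r' x) * indicator {x. ?r' x \<noteq> \<infinity>} x \<le> ennreal t * (?h x * indicator D x)" for x
    proof (rule conj_exp_cases[OF exponents_ge_1[OF r, of x]])
      fix u assume *: "r x = ennreal u" "1 < u" "?r' x = ennreal (u / (u - 1))"
      show ?thesis
      proof (cases "x \<in> D")
        case True
        have "b x epowr (u / (u - 1)) \<le> ennreal t * (f x epowr (u - 1)) epowr (u / (u - 1))"
          using * True t by (auto simp: b_def intro!: epowr_cmult_le)
        then show ?thesis using * True by (simp add: epowr_epowr)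
      next
        case False
        then show ?thesis using * by (simp add: b_def zero_epowr)
      qed
    qed (simp_all add: b_def)
    show thesis
    proof (rule that[of b])
      show "b \<in> unit_ball ?r'"
      proof (rule unit_ballI[OF _ _ _ half])
        have "b x \<le> ennreal (1 / 2)" if "?r' x = \<infinity>" for x
          using that b1 by (cases rule: conj_exp_cases[OF exponents_ge_1[OF r, of x]]) auto
        then show "AE x in lebesgue. ?r' x = \<infinity> \<longrightarrow> b x \<le> ennreal (1 / 2)"
          by blast
        have "fin_modular ?r' b \<le> (\<integral>\<^sup>+x. ennreal t * (?h x * indicator D x) \<partial>lebesgue)"
          unfolding fin_modular_def by (intro nn_integral_mono b2)
        also have "\<dots> = ennreal t * ennreal m"
          unfolding m(1)[symmetric] by (rule nn_integral_cmult) measurable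
        also have "\<dots> \<le> ennreal (1 / 2)"
          using t m by (subst ennreal_mult[symmetric]) (auto intro: ennreal_leI simp del: ennreal_half)
        finally show "fin_modular ?r' b \<le> ennreal (1 / 2)" .
      qed measurable
      have "ennreal (1 / 4) \<le> ennreal (t * m)"
        using t by (intro ennreal_leI) auto
      also have "\<dots> = ennreal t * ennreal m"
        using t m by (simp add: ennreal_mult)
      also have "\<dots> = (\<integral>\<^sup>+x. ennreal t * (?h x * indicator D x) \<partial>lebesgue)"
        unfolding m(1)[symmetric] by (rule nn_integral_cmult[symmetric]) measurable
      also have "\<dots> \<le> (\<integral>\<^sup>+x. f x * b x \<partial>lebesgue)"
      proof (intro nn_integral_mono)
        fix x
        have "f x epowr enn2real (r x) = f x epowr 1 * f x epowr (enn2real (r x) - 1)" if "r x \<noteq> \<infinity>"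
          using exponents_enn2real[OF r that] by (subst epowr_add[symmetric]) auto
        then show "ennreal t * (?h x * indicator D x) \<le> f x * b x"
          by (auto simp: b_def indicator_def mult.left_commute)
      qed
      finally show "ennreal (1 / 4) \<le> (\<integral>\<^sup>+x. f x * b x \<partial>lebesgue)" .
    qed
  next
    case inf
    define E where "E = {x. r x = \<infinity>} \<inter> {x. ennreal (1 / 2) < f x}"
    have "{x \<in> space lebesgue. ennreal (1 / 2) < f x} \<in> sets lebesgue" by measurable
    then have E[measurable]: "E \<in> sets lebesgue"
      unfolding E_def by (intro sets.Int sets_infinite_exponent exponents_measurable[OF r]) simp
    have "emeasure lebesgue E \<noteq> 0"
    proof
      assume "emeasure lebesgue E = 0"
      then have "E \<in> null_sets lebesgue" using E by auto
      then have "AE x in lebesgue. x \<notin> E" by (rule AE_not_in)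
      then have "AE x in lebesgue. r x = \<infinity> \<longrightarrow> f x \<le> ennreal (1 / 2)"
        by eventually_elim (auto simp: E_def not_less simp del: ennreal_half)
      with inf show False by simp
    qed
    then have "0 < (\<integral>\<^sup>+x. indicator E x \<partial>lebesgue)"
      by (simp add: zero_less_iff_neq_zero)
    then obtain D where [measurable]: "D \<in> sets lebesgue"
      and D: "0 < (\<integral>\<^sup>+x\<in>D. indicator E x \<partial>lebesgue)" "(\<integral>\<^sup>+x\<in>D. indicator E x \<partial>lebesgue) < \<infinity>"
      by (rule finite_part_of_integral[of "indicator E" 0, rotated 2]) (auto simp: indicator_def)
    then obtain m where m: "(\<integral>\<^sup>+x\<in>D. indicator E x \<partial>lebesgue) = ennreal m" "0 < m"
      by (cases "\<integral>\<^sup>+x\<in>D. indicator E x \<partial>lebesgue") auto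
    define b where "b = (\<lambda>x. ennreal (1 / m) * (indicator E x * indicator D x) :: ennreal)"
    have [measurable]: "b \<in> borel_measurable lebesgue" unfolding b_def by measurable
    have int_b: "(\<integral>\<^sup>+x. b x \<partial>lebesgue) = 1"
      unfolding b_def using m by (subst nn_integral_cmult) (auto simp flip: ennreal_mult)
    have b0: "b x \<le> 0" if "r x \<noteq> \<infinity>" for x
      using that by (auto simp: b_def E_def)
    show thesis
    proof (rule that[of b])
      have *: "1 + 0 \<le> (1::ennreal)" by simp
      show "b \<in> unit_ball ?r'"
      proof (rule unit_ballI[OF _ _ _ *])
        have "b x \<le> 0" if "?r' x = \<infinity>" for x
          using that b0[of x] by (cases rule: conj_exp_cases[OF exponents_ge_1[OF r, of x]]) auto
        then show "AE x in lebesgue. ?r' x = \<infinity> \<longrightarrow> b x \<le> 0"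
          by blast
        have "fin_modular ?r' b \<le> (\<integral>\<^sup>+x. b x \<partial>lebesgue)"
          unfolding fin_modular_def
        proof (intro nn_integral_mono)
          fix x show "b x epowr enn2real (?r' x) * indicator {x. ?r' x \<noteq> \<infinity>} x \<le> b x"
          proof (rule conj_exp_cases[OF exponents_ge_1[OF r, of x]])
            fix u assume *: "r x = ennreal u" "1 < u" "?r' x = ennreal (u / (u - 1))"
            then have "b x = 0" using b0[of x] by simp
            then show ?thesis using * by (simp add: zero_epowr)
          qed simp_all
        qed
        then show "fin_modular ?r' b \<le> 1" by (simp only: int_b)
      qed measurable
      have "ennreal (1 / 4) \<le> ennreal (1 / 2) * (\<integral>\<^sup>+x. b x \<partial>lebesgue)"
        unfolding int_b mult_1_right by (rule ennreal_leI) simp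
      also have "\<dots> = (\<integral>\<^sup>+x. ennreal (1 / 2) * b x \<partial>lebesgue)"
        by (subst nn_integral_cmult) auto
      also have "\<dots> \<le> (\<integral>\<^sup>+x. f x * b x \<partial>lebesgue)"
      proof (intro nn_integral_mono)
        fix x show "ennreal (1 / 2) * b x \<le> f x * b x"
        proof (cases "x \<in> E")
          case True
          then have "ennreal (1 / 2) \<le> f x" unfolding E_def by (simp add: less_imp_le del: ennreal_half)
          then show ?thesis by (rule mult_right_mono) simp
        qed (simp add: b_def)
      qed
      finally show "ennreal (1 / 4) \<le> (\<integral>\<^sup>+x. f x * b x \<partial>lebesgue)" .
    qed
  qed
qed

section \<open>The iteration algorithm of Rubio de Francia\<close>

lemma balls_sets: "B \<in> balls \<Longrightarrow> B \<in> sets lebesgue"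
  by (auto simp: balls_def)

lemma emeasure_balls: 
  assumes "B \<in> balls"
  shows "0 < emeasure lebesgue B" "emeasure lebesgue B < \<infinity>"
proof -
  obtain c :: 'a and r where "B = ball c r" "0 < r" using assms by (auto simp: balls_def)
  then show "0 < emeasure lebesgue B" "emeasure lebesgue B < \<infinity>"
    using emeasure_bounded_finite[OF bounded_ball[of c r]] content_ball_pos[of r c]
    by (auto simp: zero_less_iff_neq_zero measure_def)
qed

lemma avg_mono_AE:
  assumes "AE x in lebesgue. x \<in> B \<longrightarrow> f x \<le> g x"
  shows "avg B f \<le> avg B g"
  unfolding avg_def using assms
  by (intro divide_right_mono_ennreal nn_integral_mono_AE) (auto elim!: eventually_mono simp: indicator_def)

lemma avg_cmult:
  assumes "B \<in> balls" and [measurable]: "f \<in> borel_measurable lebesgue"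
  shows "avg B (\<lambda>x. c * f x) = c * avg B f"
proof -
  note [measurable] = balls_sets[OF assms(1)]
  show ?thesis
    unfolding avg_def by (simp add: mult.assoc nn_integral_cmult ennreal_times_divide)
qed

lemma avg_suminf:
  assumes "B \<in> balls" and [measurable]: "\<And>k. f k \<in> borel_measurable lebesgue"
  shows "avg B (\<lambda>x. \<Sum>k. f k x) = (\<Sum>k. avg B (f k))"
proof -
  note [measurable] = balls_sets[OF assms(1)]
  show ?thesis
    unfolding avg_def
    by (simp add: nn_integral_suminf flip: ennreal_suminf_multc)
qed

text \<open>
  The maximal function is lower semicontinuous, being a supremum over open balls.
\<close>
lemma borel_measurable_maximal [measurable]: "maximal f \<in> borel_measurable lebesgue"
proof -
  have "{x. a < maximal f x} = \<Union>{B \<in> balls. a < avg B (\<lambda>y. ennreal \<bar>f y\<bar>)}" for a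
    by (auto simp: maximal_def less_SUP_iff)
  moreover have "open (\<Union>{B \<in> balls. a < avg B (\<lambda>y. ennreal \<bar>f y\<bar>)})" for a
    by (auto simp: balls_def)
  ultimately have "{x. a < maximal f x} \<in> sets lebesgue" for a
    by (metis borel_open sets_completionI_sets sets_lborel)
  then show ?thesis
    by (intro borel_measurableI_greater) simp
qed

lemma var_weights_measurable [measurable_dest]:
  "v \<in> var_weights \<Longrightarrow> v \<in> borel_measurable lebesgue"
  by (simp add: var_weights_def)

text \<open>
  The operator bound in terms of unit balls.  The constant is increased by $1$ to obtain the strict
  inequality that \<open>var_norm_less\<close> asks for.
\<close>
lemma maximal_bounded_unit_ball:
  assumes bdd: "maximal_bounded r v" and r: "r \<in> exponents" and v: "v \<in> var_weights"
  obtains C :: real where "0 < C"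
    "\<And>f. f \<in> borel_measurable lebesgue \<Longrightarrow> (\<lambda>x. ennreal \<bar>f x\<bar> * v x) \<in> unit_ball r \<Longrightarrow>
       (\<lambda>x. ennreal (1 / C) * (maximal f x * v x)) \<in> unit_ball r"
proof -
  note [measurable] = exponents_measurable[OF r] var_weights_measurable[OF v]
  obtain C :: real where C: "0 < C" "\<And>f. f \<in> borel_measurable lebesgue \<Longrightarrow>
      weighted_norm r v (\<lambda>x. ennreal \<bar>f x\<bar>) < \<infinity> \<Longrightarrow>
      weighted_norm r v (maximal f) \<le> ennreal C * weighted_norm r v (\<lambda>x. ennreal \<bar>f x\<bar>)"
    using bdd unfolding maximal_bounded_def by blast
  show thesis
  proof (rule that[of "C + 1"])
    show "0 < C + 1" using C by simp
    fix f :: "'a \<Rightarrow> real"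
    assume [measurable]: "f \<in> borel_measurable lebesgue"
      and f: "(\<lambda>x. ennreal \<bar>f x\<bar> * v x) \<in> unit_ball r"
    have "weighted_norm r v (\<lambda>x. ennreal \<bar>f x\<bar>) \<le> ennreal 1"
      unfolding weighted_norm_def by (rule var_norm_le[OF _ _ r]) (use f in simp_all)
    then have le: "weighted_norm r v (\<lambda>x. ennreal \<bar>f x\<bar>) \<le> 1" by simp
    then have "weighted_norm r v (maximal f) \<le> ennreal C * weighted_norm r v (\<lambda>x. ennreal \<bar>f x\<bar>)"
      using le_less_trans[OF le ennreal_one_less_top] by (intro C(2)) simp_all
    also have "\<dots> \<le> ennreal C"
      using mult_left_mono[OF le, of "ennreal C"] by simp
    also have "\<dots> < ennreal (C + 1)"
      using C by (intro ennreal_lessI) auto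
    finally show "(\<lambda>x. ennreal (1 / (C + 1)) * (maximal f x * v x)) \<in> unit_ball r"
      unfolding weighted_norm_def by (rule var_norm_less[OF _ r]) measurable
  qed
qed

text \<open>
  The Muckenhoupt $A_1$ condition with constant \<open>K\<close>, in the form used later: the exceptional
  null set does not depend on the ball.
\<close>
definition A_one :: "real \<Rightarrow> ('a::euclidean_space \<Rightarrow> real) \<Rightarrow> bool" where
  "A_one K H \<longleftrightarrow> (AE x in lebesgue. \<forall>B\<in>balls. x \<in> B \<longrightarrow>
     avg B (\<lambda>y. ennreal (H y)) \<le> ennreal (K * H x))"

lemma ennreal_enn2real_le: "ennreal (enn2real y) \<le> y"
  by (cases y) auto

lemma var_weights_AE: "v \<in> var_weights \<Longrightarrow> AE x in lebesgue. 0 < v x \<and> v x < \<infinity>"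
  by (simp add: var_weights_def)

lemma ennreal_divide_mult_cancel:
  fixes y v :: ennreal
  assumes "0 < v" "v < \<infinity>"
  shows "y / v * v = y"
  using assms by (simp add: ennreal_divide_times ennreal_divide_self)

text \<open>
  Iterate the maximal operator: with $h_0 = S/v$ and $h_{j+1} = M h_j / C$, all $h_j v$ lie in the
  unit ball, hence so does $H v$ for $H = \sum_j 4^{-j-1} h_j$.  Averages commute with the series
  and the average of $h_j$ is at most $M h_j = C h_{j+1}$; shifting the index gives the $A_1$
  condition with constant $4C$.  The term $j = 0$ makes $H$ dominate $S / (4v)$.
\<close>
lemma Rubio_de_Francia:
  fixes r v :: "'a::euclidean_space \<Rightarrow> ennreal"
  assumes bdd: "maximal_bounded r v" and r: "r \<in> exponents" and v: "v \<in> var_weights"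
  obtains K :: real where "0 < K"
    "\<And>S. S \<in> unit_ball r \<Longrightarrow> (\<And>x. 0 < S x) \<Longrightarrow>
      \<exists>H. H \<in> borel_measurable lebesgue \<and> (\<forall>x. 0 < H x) \<and> A_one K H \<and>
          (\<lambda>x. ennreal (H x) * v x) \<in> unit_ball r \<and>
          (AE x in lebesgue. S x \<le> ennreal (K * H x) * v x)"
proof -
  note [measurable] = exponents_measurable[OF r] var_weights_measurable[OF v]
  obtain C :: real where C: "0 < C"
    "\<And>f. f \<in> borel_measurable lebesgue \<Longrightarrow> (\<lambda>x. ennreal \<bar>f x\<bar> * v x) \<in> unit_ball r \<Longrightarrow>
       (\<lambda>x. ennreal (1 / C) * (maximal f x * v x)) \<in> unit_ball r"
    using maximal_bounded_unit_ball[OF bdd r v] by metis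
  \<comment> \<open>The $A_1$ bound costs \<open>4 * C\<close>, the comparison with \<open>S\<close> costs \<open>4\<close>.\<close>
  define K where "K = 4 * C + 4"
  show thesis
  proof (rule that[of K])
    show "0 < K" using C by (simp add: K_def)
    fix S :: "'a \<Rightarrow> ennreal"
    assume S: "S \<in> unit_ball r" and pos: "\<And>x. 0 < S x"
    note [measurable] = unit_ball_measurable[OF S]
    define h where "h = rec_nat (\<lambda>x. enn2real (S x / v x)) (\<lambda>_ f x. enn2real (maximal f x) / C)"
    have h_0: "h 0 = (\<lambda>x. enn2real (S x / v x))"
      and h_Suc: "h (Suc j) = (\<lambda>x. enn2real (maximal (h j) x) / C)" for j
      by (simp_all add: h_def)
    have h_nonneg: "0 \<le> h j x" for j x
      using C by (cases j) (simp_all add: h_0 h_Suc)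
    have [measurable]: "h j \<in> borel_measurable lebesgue" for j
      by (cases j) (simp_all add: h_0 h_Suc)
    have h_unit: "(\<lambda>x. ennreal (h j x) * v x) \<in> unit_ball r" for j
    proof (induction j)
      case 0
      show ?case
      proof (rule unit_ball_mono[OF S])
        show "AE x in lebesgue. ennreal (h 0 x) * v x \<le> S x"
          using var_weights_AE[OF v]
        proof eventually_elim
          case (elim x)
          have "ennreal (h 0 x) * v x \<le> S x / v x * v x"
            unfolding h_0 by (intro mult_right_mono ennreal_enn2real_le) simp
          then show ?case using elim by (simp add: ennreal_divide_mult_cancel)
        qed
      qed measurable
    next
      case (Suc j)
      have "(\<lambda>x. ennreal \<bar>h j x\<bar> * v x) \<in> unit_ball r"
        using Suc h_nonneg by simp
      then have "(\<lambda>x. ennreal (1 / C) * (maximal (h j) x * v x)) \<in> unit_ball r"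
        by (intro C(2)) measurable
      then show ?case
      proof (rule unit_ball_mono)
        have "ennreal (h (Suc j) x) * v x \<le> ennreal (1 / C) * (maximal (h j) x * v x)" for x
        proof -
          have "ennreal (h (Suc j) x) = ennreal (1 / C) * ennreal (enn2real (maximal (h j) x))"
            using C by (simp add: h_Suc flip: ennreal_mult)
          also have "\<dots> * v x \<le> ennreal (1 / C) * maximal (h j) x * v x"
            by (intro mult_right_mono mult_left_mono ennreal_enn2real_le) auto
          finally show ?thesis by (simp add: mult.assoc)
        qed
        then show "AE x in lebesgue. ennreal (h (Suc j) x) * v x \<le> ennreal (1 / C) * (maximal (h j) x * v x)"
          by simp
      qed measurable
    qed
    have maximal_h: "AE x in lebesgue. \<forall>j. maximal (h j) x = ennreal (C * h (Suc j) x)"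
      unfolding AE_all_countable
    proof
      fix j
      have "(\<lambda>x. ennreal \<bar>h j x\<bar> * v x) \<in> unit_ball r"
        using h_unit h_nonneg by simp
      then have "(\<lambda>x. ennreal (1 / C) * (maximal (h j) x * v x)) \<in> unit_ball r"
        by (intro C(2)) measurable
      from unit_ball_finite[OF this r] var_weights_AE[OF v]
      show "AE x in lebesgue. maximal (h j) x = ennreal (C * h (Suc j) x)"
      proof eventually_elim
        case (elim x)
        have "maximal (h j) x < \<infinity>"
        proof (rule ccontr)
          assume "\<not> maximal (h j) x < \<infinity>"
          then have "maximal (h j) x = \<infinity>" by (simp add: not_less top_unique)
          then have "ennreal (1 / C) * (maximal (h j) x * v x) = \<infinity>"
            using elim(2) C(1) by (auto simp: ennreal_mult_eq_top_iff ennreal_top_mult)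
          with elim show False by simp
        qed
        then show ?case using C by (simp add: h_Suc)
      qed
    qed
    \<comment> \<open>The series may be infinite on a null set; \<open>H\<close> below is a version of it with positive real values.\<close>
    define H0 where "H0 = (\<lambda>x. \<Sum>j. ennreal ((1 / 4) ^ Suc j) * ennreal (h j x))"
    have [measurable]: "H0 \<in> borel_measurable lebesgue" unfolding H0_def by measurable
    have "(\<lambda>x. \<Sum>j. ennreal ((1 / 4) ^ Suc j) * (ennreal (h j x) * v x)) \<in> unit_ball r"
      by (rule unit_ball_suminf[OF r h_unit])
    also have "(\<lambda>x. \<Sum>j. ennreal ((1 / 4) ^ Suc j) * (ennreal (h j x) * v x)) = (\<lambda>x. H0 x * v x)"
      unfolding H0_def by (simp add: mult.assoc[symmetric])
    finally have H0_unit: "(\<lambda>x. H0 x * v x) \<in> unit_ball r" .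
    have S_le: "AE x in lebesgue. S x \<le> 4 * H0 x * v x"
      using var_weights_AE[OF v] unit_ball_finite[OF S r]
    proof eventually_elim
      case (elim x)
      have "S x / v x < \<infinity>"
        using elim by (auto simp: ennreal_divide_eq_top_iff less_top[symmetric])
      then have "S x = ennreal (h 0 x) * v x"
        using elim by (simp add: h_0 ennreal_divide_mult_cancel)
      also have "ennreal (h 0 x) = 4 * (ennreal ((1 / 4) ^ Suc 0) * ennreal (h 0 x))"
        using h_nonneg[of 0 x] by (simp add: mult.assoc[symmetric] flip: ennreal_numeral ennreal_mult)
      also have "\<dots> \<le> 4 * H0 x"
        unfolding H0_def by (intro mult_left_mono ennreal_le_suminf[of "\<lambda>j. ennreal ((1 / 4) ^ Suc j) * ennreal (h j x)"]) simp
      finally show ?case by (simp add: mult_right_mono)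
    qed
    define H where "H = (\<lambda>x. if 0 < H0 x \<and> H0 x < \<infinity> then enn2real (H0 x) else 1)"
    have [measurable]: "H \<in> borel_measurable lebesgue" unfolding H_def by measurable
    have H_pos: "0 < H x" for x
      by (auto simp: H_def enn2real_positive_iff)
    have H_eq: "AE x in lebesgue. ennreal (H x) = H0 x"
      using S_le unit_ball_finite[OF H0_unit r] var_weights_AE[OF v]
    proof eventually_elim
      case (elim x)
      have "H0 x \<noteq> 0" using elim(1) pos[of x] by auto
      moreover have "H0 x < \<infinity>"
        using elim by (auto simp: ennreal_mult_less_top)
      ultimately show ?case by (simp add: H_def zero_less_iff_neq_zero)
    qed
    have "A_one K H"
      unfolding A_one_def using maximal_h H_eq
    proof eventually_elim
      case (elim x)
      show ?case
      proof (intro ballI impI)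
        fix B :: "'a set" assume B: "B \<in> balls" "x \<in> B"
        have "avg B (\<lambda>y. ennreal (H y)) \<le> avg B H0"
          using H_eq by (intro avg_mono_AE) (auto elim: eventually_mono)
        also have "\<dots> = (\<Sum>j. ennreal ((1 / 4) ^ Suc j) * avg B (\<lambda>y. ennreal (h j y)))"
          unfolding H0_def by (subst avg_suminf[OF B(1)]) (measurable, subst avg_cmult[OF B(1)], simp_all)
        also have "\<dots> \<le> (\<Sum>j. ennreal (4 * C) * (ennreal ((1 / 4) ^ Suc (Suc j)) * ennreal (h (Suc j) x)))"
        proof (intro suminf_le summableI)
          fix j
          have "avg B (\<lambda>y. ennreal (h j y)) \<le> maximal (h j) x"
            unfolding maximal_def using B h_nonneg by (intro SUP_upper2[of B]) auto
          then have "ennreal ((1 / 4) ^ Suc j) * avg B (\<lambda>y. ennreal (h j y))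
              \<le> ennreal ((1 / 4) ^ Suc j) * ennreal (C * h (Suc j) x)"
            using elim by (intro mult_left_mono) auto
          also have "\<dots> = ennreal (4 * C) * (ennreal ((1 / 4) ^ Suc (Suc j)) * ennreal (h (Suc j) x))"
            using C h_nonneg[of "Suc j" x] by (simp add: mult_ac flip: ennreal_mult)
          finally show "ennreal ((1 / 4) ^ Suc j) * avg B (\<lambda>y. ennreal (h j y))
              \<le> ennreal (4 * C) * (ennreal ((1 / 4) ^ Suc (Suc j)) * ennreal (h (Suc j) x))" .
        qed
        also have "\<dots> = ennreal (4 * C) * (\<Sum>j. ennreal ((1 / 4) ^ Suc (Suc j)) * ennreal (h (Suc j) x))"
          by (rule ennreal_suminf_cmult)
        also have "\<dots> \<le> ennreal (4 * C) * H0 x"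
          unfolding H0_def
          by (subst suminf_offset[OF summableI, of "\<lambda>j. ennreal ((1 / 4) ^ Suc j) * ennreal (h j x)" 1])
             (intro mult_left_mono, simp_all)
        also have "\<dots> \<le> ennreal (K * H x)"
          unfolding elim(2)[symmetric] using C(1) H_pos[of x]
          by (subst ennreal_mult[symmetric]) (auto simp: K_def intro!: ennreal_leI mult_right_mono)
        finally show "avg B (\<lambda>y. ennreal (H y)) \<le> ennreal (K * H x)" .
      qed
    qed
    moreover have "(\<lambda>x. ennreal (H x) * v x) \<in> unit_ball r"
      by (rule unit_ball_mono[OF H0_unit]) (use H_eq in \<open>auto elim: eventually_mono\<close>)
    moreover have "AE x in lebesgue. S x \<le> ennreal (K * H x) * v x"
      using S_le H_eq
    proof eventually_elim
      case (elim x)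
      have "4 * H0 x \<le> ennreal (K * H x)"
        unfolding elim(2)[symmetric] ennreal_numeral[symmetric] using C(1) H_pos[of x]
        by (subst ennreal_mult[symmetric]) (auto simp: K_def intro!: ennreal_leI mult_right_mono)
      then show ?case using elim(1) by (meson mult_right_mono order.trans zero_le)
    qed
    ultimately show "\<exists>H. H \<in> borel_measurable lebesgue \<and> (\<forall>x. 0 < H x) \<and> A_one K H \<and>
          (\<lambda>x. ennreal (H x) * v x) \<in> unit_ball r \<and>
          (AE x in lebesgue. S x \<le> ennreal (K * H x) * v x)"
      using H_pos by (intro exI[of _ H]) auto
  qed
qed

section \<open>Weights built from two functions with the $A_1$ property\<close>

text \<open>
  A function with the $A_1$ property has positive finite averages and is bounded below on each ball
  by a multiple of its average, which is how negative powers of it are estimated.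
\<close>
lemma A_one_avg:
  fixes H :: "'a::euclidean_space \<Rightarrow> real"
  assumes H[measurable]: "H \<in> borel_measurable lebesgue" and pos: "\<And>x. 0 < H x"
    and A: "A_one K H" and K: "0 < K" and B: "B \<in> balls"
  obtains a where "0 < a" "avg B (\<lambda>y. ennreal (H y)) = ennreal a"
    "AE x in lebesgue. x \<in> B \<longrightarrow> a / K \<le> H x"
proof -
  note [measurable] = balls_sets[OF B]
  have not_null: "\<not> (AE x in lebesgue. x \<notin> B)"
    using emeasure_balls(1)[OF B] by (subst AE_iff_null_sets[symmetric]) (auto simp: null_sets_def)
  have le: "AE x in lebesgue. x \<in> B \<longrightarrow> avg B (\<lambda>y. ennreal (H y)) \<le> ennreal (K * H x)"
    using A B unfolding A_one_def by (auto elim: eventually_mono)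
  have "\<exists>x\<in>B. avg B (\<lambda>y. ennreal (H y)) \<le> ennreal (K * H x)"
  proof (rule ccontr)
    assume "\<not> ?thesis"
    with le have "AE x in lebesgue. x \<notin> B" by (auto elim: eventually_mono)
    with not_null show False by simp
  qed
  then have "avg B (\<lambda>y. ennreal (H y)) \<noteq> \<infinity>" by (auto simp: top_unique)
  moreover have "avg B (\<lambda>y. ennreal (H y)) \<noteq> 0"
  proof
    assume "avg B (\<lambda>y. ennreal (H y)) = 0"
    then have "(\<integral>\<^sup>+y\<in>B. ennreal (H y) \<partial>lebesgue) = 0"
      using emeasure_balls(2)[OF B] by (auto simp: avg_def ennreal_divide_eq_0_iff)
    then have "AE y in lebesgue. ennreal (H y) * indicator B y = 0"
      by (subst (asm) nn_integral_0_iff_AE) auto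
    then have "AE y in lebesgue. y \<notin> B"
    proof eventually_elim
      case (elim y)
      then show ?case using pos[of y] by (auto simp: indicator_def split: if_splits)
    qed
    with not_null show False by simp
  qed
  ultimately obtain a where a: "avg B (\<lambda>y. ennreal (H y)) = ennreal a" "0 < a"
    by (cases "avg B (\<lambda>y. ennreal (H y))" rule: ennreal_pos_cases) auto
  have "AE x in lebesgue. x \<in> B \<longrightarrow> a / K \<le> H x"
    using le
  proof eventually_elim
    case (elim x)
    have "0 \<le> K * H x" using K pos[of x] by simp
    then show ?case using elim K unfolding a(1) by (auto simp: field_simps)
  qed
  with a show thesis using that by blast
qed

text \<open>
  The weight $w_0 = H^{1/p-1} G^{1/q}$.  Its power $w_0^q = H^{1-r} G$ with $r = 1 + q/p'$ is the
  factorised form of an $A_r$ weight, and $w_0 \in A_{p,q}$ is equivalent to $w_0^q \in A_r$.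
  For $p = 1$ the function $H$ drops out.
\<close>
definition factored_weight ::
  "real \<Rightarrow> real \<Rightarrow> ('a \<Rightarrow> real) \<Rightarrow> ('a \<Rightarrow> real) \<Rightarrow> 'a \<Rightarrow> ennreal" where
  "factored_weight p q H G x = ennreal (H x powr (1 / p - 1) * G x powr (1 / q))"

lemma factored_weight_epowr:
  assumes "0 < H x" "0 < G x"
  shows "factored_weight p q H G x epowr a = ennreal (H x powr ((1 / p - 1) * a) * G x powr (a / q))"
  using assms by (simp add: factored_weight_def epowr_ennreal powr_mult powr_powr)

text \<open>
  In the average of $w_0^q$ the factor $H^{-q/p'}$ is at most a power of the average of $H$, and in
  the average of $w_0^{-p'}$ the factor $G^{-p'/q}$ is at most a power of the average of $G$.  In
  the product of the two the averages cancel.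
\<close>
lemma factored_weight_A_const:
  fixes H G :: "'a::euclidean_space \<Rightarrow> real"
  assumes p: "1 < p" and q: "0 < q"
    and H[measurable]: "H \<in> borel_measurable lebesgue" and H_pos: "\<And>x. 0 < H x"
    and AH: "A_one K H" and K: "0 < K"
    and G[measurable]: "G \<in> borel_measurable lebesgue" and G_pos: "\<And>x. 0 < G x"
    and AG: "A_one L G" and L: "0 < L"
  shows "factored_weight p q H G \<in> A_const p q"
proof -
  define s where "s = p / (p - 1)"
  have s: "0 < s" "1 / p - 1 = - (1 / s)" "0 < p - 1"
    using p by (auto simp: s_def field_simps)
  let ?w = "factored_weight p q H G"
  have [measurable]: "?w \<in> borel_measurable lebesgue"
    unfolding factored_weight_def[abs_def] by measurable
  have "avg B (\<lambda>x. ?w x epowr q) epowr (1 / q) * avg B (\<lambda>x. ?w x epowr (- s)) epowr (1 / s)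
      \<le> ennreal (K powr (1 / s) * L powr (1 / q))" if B: "B \<in> balls" for B
  proof -
    obtain a where a: "0 < a" "avg B (\<lambda>y. ennreal (H y)) = ennreal a"
      "AE x in lebesgue. x \<in> B \<longrightarrow> a / K \<le> H x"
      by (rule A_one_avg[OF H H_pos AH K B])
    obtain b where b: "0 < b" "avg B (\<lambda>y. ennreal (G y)) = ennreal b"
      "AE x in lebesgue. x \<in> B \<longrightarrow> b / L \<le> G x"
      by (rule A_one_avg[OF G G_pos AG L B])
    have "avg B (\<lambda>x. ?w x epowr q) \<le> avg B (\<lambda>x. ennreal ((a / K) powr (- q / s)) * ennreal (G x))"
    proof (rule avg_mono_AE)
      show "AE x in lebesgue. x \<in> B \<longrightarrow> ?w x epowr q \<le> ennreal ((a / K) powr (- q / s)) * ennreal (G x)"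
        using a(3)
      proof eventually_elim
        case (elim x)
        show ?case
        proof
          assume "x \<in> B"
          then have "H x powr (- q / s) \<le> (a / K) powr (- q / s)"
            using elim a K s q by (intro powr_mono2') auto
          then show "?w x epowr q \<le> ennreal ((a / K) powr (- q / s)) * ennreal (G x)"
            using s q H_pos[of x] G_pos[of x]
            by (subst ennreal_mult[symmetric])
               (auto simp: factored_weight_epowr intro!: ennreal_leI mult_right_mono)
        qed
      qed
    qed
    also have "\<dots> = ennreal ((a / K) powr (- q / s) * b)"
      using b(1) by (simp add: avg_cmult[OF B] b(2) ennreal_mult)
    finally have 1: "avg B (\<lambda>x. ?w x epowr q) epowr (1 / q) \<le> ennreal ((a / K) powr (- 1 / s) * b powr (1 / q))"
      using epowr_mono[of "1 / q" "avg B (\<lambda>x. ?w x epowr q)" "ennreal ((a / K) powr (- q / s) * b)"] q a b K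
      by (simp add: epowr_ennreal powr_mult powr_powr)
    have "avg B (\<lambda>x. ?w x epowr (- s)) \<le> avg B (\<lambda>x. ennreal ((b / L) powr (- s / q)) * ennreal (H x))"
    proof (rule avg_mono_AE)
      show "AE x in lebesgue. x \<in> B \<longrightarrow> ?w x epowr (- s) \<le> ennreal ((b / L) powr (- s / q)) * ennreal (H x)"
        using b(3)
      proof eventually_elim
        case (elim x)
        show ?case
        proof
          assume "x \<in> B"
          then have "G x powr (- s / q) \<le> (b / L) powr (- s / q)"
            using elim b L s q by (intro powr_mono2') auto
          then show "?w x epowr (- s) \<le> ennreal ((b / L) powr (- s / q)) * ennreal (H x)"
            using s q H_pos[of x] G_pos[of x]
            by (subst ennreal_mult[symmetric])
               (auto simp: factored_weight_epowr mult.commute[of "H x"] intro!: ennreal_leI mult_right_mono)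
        qed
      qed
    qed
    also have "\<dots> = ennreal ((b / L) powr (- s / q) * a)"
      using a(1) by (simp add: avg_cmult[OF B] a(2) ennreal_mult)
    finally have 2: "avg B (\<lambda>x. ?w x epowr (- s)) epowr (1 / s) \<le> ennreal ((b / L) powr (- 1 / q) * a powr (1 / s))"
      using epowr_mono[of "1 / s" "avg B (\<lambda>x. ?w x epowr (- s))" "ennreal ((b / L) powr (- s / q) * a)"] s a b L
      by (simp add: epowr_ennreal powr_mult powr_powr)
    have "avg B (\<lambda>x. ?w x epowr q) epowr (1 / q) * avg B (\<lambda>x. ?w x epowr (- s)) epowr (1 / s)
        \<le> ennreal ((a / K) powr (- 1 / s) * b powr (1 / q)) * ennreal ((b / L) powr (- 1 / q) * a powr (1 / s))"
      by (intro mult_mono 1 2) auto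
    also have "\<dots> = ennreal (((a / K) powr (- 1 / s) * b powr (1 / q)) * ((b / L) powr (- 1 / q) * a powr (1 / s)))"
      by (simp add: ennreal_mult)
    also have "((a / K) powr (- 1 / s) * b powr (1 / q)) * ((b / L) powr (- 1 / q) * a powr (1 / s))
        = K powr (1 / s) * L powr (1 / q)"
      using a b K L by (simp add: powr_divide powr_minus field_simps)
    finally show ?thesis .
  qed
  then have "(SUP B\<in>balls. avg B (\<lambda>x. ?w x epowr q) epowr (1 / q) * avg B (\<lambda>x. ?w x epowr (- s)) epowr (1 / s))
      \<le> ennreal (K powr (1 / s) * L powr (1 / q))"
    by (rule SUP_least)
  also have "\<dots> < \<infinity>" by simp
  finally show ?thesis
    using p unfolding A_const_def s_def by simp
qed

lemma factored_weight_A_const_one: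
  fixes H G :: "'a::euclidean_space \<Rightarrow> real"
  assumes q: "0 < q"
    and H[measurable]: "H \<in> borel_measurable lebesgue" and H_pos: "\<And>x. 0 < H x"
    and G[measurable]: "G \<in> borel_measurable lebesgue" and G_pos: "\<And>x. 0 < G x"
    and AG: "A_one L G" and L: "0 < L"
  shows "factored_weight 1 q H G \<in> A_const 1 q"
proof -
  let ?w = "factored_weight 1 q H G"
  have [measurable]: "?w \<in> borel_measurable lebesgue"
    unfolding factored_weight_def[abs_def] by measurable
  have w: "?w x epowr q = ennreal (G x)" for x
    using q H_pos[of x] G_pos[of x] by (simp add: factored_weight_epowr)
  have "avg B (\<lambda>x. ?w x epowr q) / essinf_on B (\<lambda>x. ?w x epowr q) \<le> ennreal L" if B: "B \<in> balls" for B
  proof -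
    obtain b where b: "0 < b" "avg B (\<lambda>y. ennreal (G y)) = ennreal b"
      "AE x in lebesgue. x \<in> B \<longrightarrow> b / L \<le> G x"
      by (rule A_one_avg[OF G G_pos AG L B])
    have "ennreal (b / L) \<le> essinf_on B (\<lambda>x. ennreal (G x))"
      unfolding essinf_on_def using b(3)
      by (intro Sup_upper) (auto elim!: eventually_mono intro: ennreal_leI)
    then have "ennreal b / essinf_on B (\<lambda>x. ennreal (G x)) \<le> ennreal L"
      using b(1) L
      by (cases "essinf_on B (\<lambda>x. ennreal (G x))" rule: ennreal_pos_cases)
         (auto simp: divide_ennreal field_simps intro!: ennreal_leI)
    then show ?thesis by (simp add: w b(2))
  qed
  then have "(SUP B\<in>balls. avg B (\<lambda>x. ?w x epowr q) / essinf_on B (\<lambda>x. ?w x epowr q)) \<le> ennreal L"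
    by (rule SUP_least)
  also have "\<dots> < \<infinity>" by simp
  finally show ?thesis unfolding A_const_def by simp
qed

section \<open>Pointwise identities for the factored weight\<close>

text \<open>
  With $z = f^\sigma/H$ this is the identity $f^q w_0^q = H G\, z^{q/\sigma}$.  Since also
  $f^\sigma G = H G\, z$, the integrals of both functions can be compared through powers of $z$.
\<close>
lemma factored_weight_left:
  fixes f :: ennreal
  assumes pq: "0 < p" "0 < q" "0 < \<sigma>" "1 / \<sigma> = 1 - 1 / p + 1 / q"
    and pos: "0 < H x" "0 < G x"
  shows "f epowr q * factored_weight p q H G x epowr q
    = ennreal (H x * G x) * (f epowr \<sigma> * ennreal (1 / H x)) epowr (q / \<sigma>)"
proof (cases f rule: ennreal_pos_cases)
  case 1
  then show ?thesis using pq by (simp add: zero_epowr)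
next
  case 2
  then show ?thesis
    using pq pos by (simp add: epowr_eq_top[THEN iffD2] ennreal_top_mult ennreal_mult_top factored_weight_epowr)
next
  case (3 t)
  have e: "(1 / p - 1) * q = 1 - q / \<sigma>"
    using pq by (simp add: divide_inverse) (simp add: field_simps)
  have "f epowr q * factored_weight p q H G x epowr q = ennreal (t powr q * (H x powr (1 - q / \<sigma>) * G x))"
    using 3 pos pq by (simp add: factored_weight_epowr epowr_ennreal e flip: ennreal_mult)
  also have "t powr q * (H x powr (1 - q / \<sigma>) * G x) = H x * G x * (t powr \<sigma> * (1 / H x)) powr (q / \<sigma>)"
  proof -
    have "H x powr (1 - q / \<sigma>) = H x / H x powr (q / \<sigma>)"
      using pos by (simp add: powr_diff)
    moreover have "(t powr \<sigma> * (1 / H x)) powr (q / \<sigma>) = t powr q / H x powr (q / \<sigma>)"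
      using 3 pos pq by (simp add: powr_divide powr_powr)
    ultimately show ?thesis by simp
  qed
  also have "ennreal \<dots> = ennreal (H x * G x) * (f epowr \<sigma> * ennreal (1 / H x)) epowr (q / \<sigma>)"
    using 3 pos pq by (simp add: epowr_ennreal flip: ennreal_mult)
  finally show ?thesis .
qed

text \<open>
  A linear substitute for Hoelder's inequality between $z$ and $z^a$; the free parameter \<open>d\<close> makes
  the first term as small as desired.
\<close>
lemma le_add_scaled_epowr:
  assumes "0 < d" "1 \<le> a"
  shows "z \<le> ennreal d + ennreal (d powr (1 - a)) * z epowr a"
proof (cases "z \<le> ennreal d")
  case True
  then show ?thesis by (simp add: add_increasing2)
next
  case False
  show ?thesis
  proof (cases z rule: ennreal_pos_cases)
    case 2
    then show ?thesis using assms by (simp add: epowr_eq_top[THEN iffD2] ennreal_mult_top)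
  next
    case (3 t)
    with False assms have t: "d < t" by simp
    have "t = t powr (1 - a) * t powr a"
      using 3 by (simp flip: powr_add)
    also have "\<dots> \<le> d powr (1 - a) * t powr a"
      using assms t by (intro mult_right_mono powr_mono2') auto
    also have "\<dots> \<le> d + d powr (1 - a) * t powr a"
      using assms by simp
    finally show ?thesis
      using 3 assms by (simp add: epowr_ennreal flip: ennreal_mult ennreal_plus)
  qed (use False in simp)
qed

lemma weighted_power_le_add:
  fixes a b :: real
  assumes "0 < a" "0 < b" "0 \<le> t" "t \<le> 1"
  shows "a powr (1 - t) * b powr t \<le> a + b"
proof (cases "a \<le> b")
  case True
  then have "a powr (1 - t) * b powr t \<le> b powr (1 - t) * b powr t"
    using assms by (intro mult_right_mono powr_mono2) auto
  also have "\<dots> = b" using assms by (simp flip: powr_add)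
  finally show ?thesis using assms by simp
next
  case False
  then have "a powr (1 - t) * b powr t \<le> a powr (1 - t) * a powr t"
    using assms by (intro mult_left_mono powr_mono2) auto
  also have "\<dots> = a" using assms by (simp flip: powr_add)
  finally show ?thesis using assms by simp
qed

text \<open>
  With $\gamma = 1/p-1/q$, $\theta = p/q$ and $\zeta = (gw)^{(1-\gamma P)\sigma} / (w^\sigma H)$ there is the identity
    $g^p w_0^p = (gw)^{P(1-\theta)} (HG)^\theta \zeta^{p/\sigma}$.
  Here $\zeta \le E$ enters with a power that does not involve the variable exponent $P$.
  The value $P = 0$ stands for an infinite exponent, which forces $\theta = 1$.
\<close>
lemma factored_weight_right:
  fixes g w :: ennreal
  assumes pq: "1 \<le> p" "p \<le> q" "0 < \<sigma>" "1 / \<sigma> = 1 - 1 / p + 1 / q"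
    and pos: "0 < H x" "0 < G x" and w: "0 < w" "w < \<infinity>" and g: "g * w < \<infinity>"
    and E: "0 < E" and P: "0 \<le> P" "P = 0 \<longrightarrow> p = q"
    and le: "((g * w) epowr (1 - (1 / p - 1 / q) * P)) epowr \<sigma> \<le> ennreal (E * H x) * w epowr \<sigma>"
  shows "g epowr p * factored_weight p q H G x epowr p
    \<le> ennreal (E powr (p / \<sigma>)) * ((if P = 0 then 0 else (g * w) epowr P) + ennreal (H x * G x))"
proof (cases g rule: ennreal_pos_cases)
  case 1
  then show ?thesis using pq by (simp add: zero_epowr)
next
  case 2
  then show ?thesis using g w by (auto simp: ennreal_top_mult)
next
  case (3 t)
  obtain W where W: "w = ennreal W" "0 < W"
    using w by (cases w rule: ennreal_pos_cases) auto
  define y where "y = t * W"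
  have y: "g * w = ennreal y" "0 < y" "t = y / W"
    using 3 W by (simp_all add: y_def ennreal_mult)
  define th where "th = p / q"
  have th: "0 < th" "th \<le> 1" "P = 0 \<longrightarrow> th = 1"
    using pq P by (auto simp: th_def)
  define e where "e = 1 - (1 / p - 1 / q) * P"
  define z where "z = y powr (e * \<sigma>) / (W powr \<sigma> * H x)"
  have z: "0 < z" "z \<le> E"
  proof -
    show "0 < z" using y W pos by (simp add: z_def)
    have "y powr (e * \<sigma>) \<le> E * H x * W powr \<sigma>"
      using le E pos y(2) W unfolding y(1) e_def[symmetric]
      by (simp add: epowr_ennreal powr_powr flip: ennreal_mult)
    then show "z \<le> E" using W pos by (simp add: z_def field_simps)
  qed
  have 1: "p / \<sigma> = p - 1 + th"
    using pq by (simp add: th_def divide_inverse) (simp add: field_simps)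
  have 2: "e * p = p - (1 - th) * P"
    using pq by (simp add: e_def th_def field_simps)
  have "t powr p * (H x powr ((1 / p - 1) * p) * G x powr (p / q))
      = (y powr ((1 - th) * P) * (H x * G x) powr th) * z powr (p / \<sigma>)"
  proof -
    have "z powr (p / \<sigma>) = y powr (e * p) / (W powr p * H x powr (p / \<sigma>))"
      using pq y W pos by (simp add: z_def powr_divide powr_mult powr_powr)
    also have "\<dots> = y powr p / y powr ((1 - th) * P) / (W powr p * (H x powr (p - 1) * H x powr th))"
      unfolding 1 2 using y pos by (simp add: powr_diff powr_add)
    finally have z': "z powr (p / \<sigma>) = y powr p / y powr ((1 - th) * P) / (W powr p * (H x powr (p - 1) * H x powr th))" .
    have "(1 / p - 1) * p = - (p - 1)" using pq by (simp add: field_simps)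
    then have "H x powr ((1 / p - 1) * p) = 1 / H x powr (p - 1)"
      by (simp only: powr_minus_divide)
    then have "t powr p * (H x powr ((1 / p - 1) * p) * G x powr (p / q)) = y powr p / W powr p * (1 / H x powr (p - 1) * G x powr th)"
      using y W by (simp add: powr_divide th_def)
    then show ?thesis
      unfolding z' using y W pos by (simp add: powr_mult)
  qed
  also have "\<dots> \<le> ((if P = 0 then 0 else y powr P) + H x * G x) * E powr (p / \<sigma>)"
  proof (intro mult_mono)
    show "y powr ((1 - th) * P) * (H x * G x) powr th \<le> (if P = 0 then 0 else y powr P) + H x * G x"
    proof (cases "P = 0")
      case True
      then show ?thesis using th y pos by simp
    next
      case False
      then show ?thesis
        using weighted_power_le_add[of "y powr P" "H x * G x" th] th y pos
        by (simp add: powr_powr mult.commute)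
    qed
    show "z powr (p / \<sigma>) \<le> E powr (p / \<sigma>)"
      using z pq by (intro powr_mono2) auto
  qed (use pos in auto)
  finally have "ennreal (t powr p * (H x powr ((1 / p - 1) * p) * G x powr (p / q)))
      \<le> ennreal (((if P = 0 then 0 else y powr P) + H x * G x) * E powr (p / \<sigma>))"
    by (rule ennreal_leI)
  also have "ennreal (((if P = 0 then 0 else y powr P) + H x * G x) * E powr (p / \<sigma>))
      = ennreal (E powr (p / \<sigma>)) * ((if P = 0 then 0 else (g * w) epowr P) + ennreal (H x * G x))"
    unfolding y(1) using y(2) pos
    by (simp add: epowr_ennreal ennreal_mult ennreal_plus mult.commute)
  also have "ennreal (t powr p * (H x powr ((1 / p - 1) * p) * G x powr (p / q)))
      = g epowr p * factored_weight p q H G x epowr p"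
    using 3 pos by (simp add: factored_weight_epowr epowr_ennreal ennreal_mult)
  finally show ?thesis .
qed

section \<open>Rescaled exponents\<close>

lemma enn2real_one_div: "1 \<le> y \<Longrightarrow> enn2real (1 / y) = 1 / enn2real y"
proof (cases y)
  case (real t)
  assume "1 \<le> y"
  with real have "0 < t" by simp
  then show ?thesis using real by (simp add: divide_ennreal flip: ennreal_1)
qed simp

lemma divide_const_eq_top_iff: "0 < \<sigma> \<Longrightarrow> y / ennreal \<sigma> = \<infinity> \<longleftrightarrow> y = \<infinity>"
  by (auto simp: ennreal_divide_eq_top_iff)

lemma enn2real_divide_const: "0 < \<sigma> \<Longrightarrow> enn2real (y / ennreal \<sigma>) = enn2real y / \<sigma>"
  by (cases y) (simp_all add: divide_ennreal ennreal_top_divide)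

text \<open>
  Infinite exponents have real part $0$, and $1/0 = 0$ makes the relation between the reciprocals
  valid for them as well.  The exponent $1 - \gamma p$ is the quotient $p/q$, and it vanishes where
  $q$ is infinite and $p$ is not.
\<close>
lemma exponent_relation:
  fixes p q :: "'a::euclidean_space \<Rightarrow> ennreal" and \<gamma> \<sigma> :: real
  assumes p: "p \<in> exponents" and q: "q \<in> exponents"
    and rel: "enn2real (1 / p x) - enn2real (1 / q x) = \<gamma>" and \<gamma>: "0 \<le> \<gamma>"
  shows "q x \<noteq> \<infinity> \<Longrightarrow> p x \<noteq> \<infinity> \<and> (1 - \<gamma> * enn2real (p x)) * enn2real (q x) = enn2real (p x)"
    and "q x = \<infinity> \<Longrightarrow> p x = \<infinity> \<and> \<gamma> = 0 \<or> 1 - \<gamma> * enn2real (p x) = 0"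
    and "0 \<le> 1 - \<gamma> * enn2real (p x)"
    and "p x = \<infinity> \<Longrightarrow> \<gamma> = 0"
    and "0 < \<sigma> \<Longrightarrow> 1 / \<sigma> = 1 - \<gamma> \<Longrightarrow> q x \<noteq> \<infinity> \<Longrightarrow> \<sigma> \<le> enn2real (q x)"
proof -
  define P where "P = enn2real (p x)"
  define Q where "Q = enn2real (q x)"
  have r: "1 / P - 1 / Q = \<gamma>"
    using rel exponents_ge_1[OF p, of x] exponents_ge_1[OF q, of x]
    by (simp add: enn2real_one_div P_def Q_def)
  have P: "p x = \<infinity> \<Longrightarrow> P = 0" "p x \<noteq> \<infinity> \<Longrightarrow> 1 \<le> P"
    and Q: "q x = \<infinity> \<Longrightarrow> Q = 0" "q x \<noteq> \<infinity> \<Longrightarrow> 1 \<le> Q"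
    using exponents_enn2real[OF p] exponents_enn2real[OF q] by (auto simp: P_def Q_def)
  have pq: "p x \<noteq> \<infinity> \<and> (1 - \<gamma> * P) * Q = P" if "q x \<noteq> \<infinity>"
  proof -
    have "p x \<noteq> \<infinity>"
    proof
      assume "p x = \<infinity>"
      then have "- (1 / Q) = \<gamma>" using r P by simp
      moreover have "0 < 1 / Q" using Q(2)[OF that] by simp
      ultimately show False using \<gamma> by linarith
    qed
    moreover from this have "(1 - \<gamma> * P) * Q = P"
      using P(2) Q(2)[OF that] unfolding r[symmetric] by (auto simp: field_simps)
    ultimately show ?thesis by simp
  qed
  show "q x \<noteq> \<infinity> \<Longrightarrow> p x \<noteq> \<infinity> \<and> (1 - \<gamma> * enn2real (p x)) * enn2real (q x) = enn2real (p x)"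
    using pq by (simp add: P_def Q_def)
  have q_inf: "p x = \<infinity> \<and> \<gamma> = 0 \<or> 1 - \<gamma> * P = 0" if "q x = \<infinity>"
    using r P Q(1)[OF that] by (cases "p x = \<infinity>") (auto simp: field_simps)
  then show "q x = \<infinity> \<Longrightarrow> p x = \<infinity> \<and> \<gamma> = 0 \<or> 1 - \<gamma> * enn2real (p x) = 0"
    by (simp add: P_def)
  show "0 \<le> 1 - \<gamma> * enn2real (p x)"
  proof (cases "q x = \<infinity>")
    case True
    then show ?thesis using q_inf by (auto simp: P_def)
  next
    case False
    have "0 \<le> (1 - \<gamma> * P) * Q" using pq[OF False] P by simp
    then show ?thesis using Q(2)[OF False] by (auto simp: P_def zero_le_mult_iff)
  qed
  show "p x = \<infinity> \<Longrightarrow> \<gamma> = 0"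
    using pq q_inf P by auto
  show "\<sigma> \<le> enn2real (q x)" if "0 < \<sigma>" "1 / \<sigma> = 1 - \<gamma>" "q x \<noteq> \<infinity>"
  proof -
    have "1 / P \<le> 1" using P(2) pq[OF that(3)] by simp
    then have "1 / Q \<le> 1 / \<sigma>" using r that by linarith
    then show ?thesis
      using le_imp_inverse_le[of "1 / Q" "1 / \<sigma>"] Q(2)[OF that(3)] by (simp add: Q_def)
  qed
qed

lemma divide_exponents:
  assumes q: "q \<in> exponents" and \<sigma>: "0 < \<sigma>" and le: "\<And>x. q x \<noteq> \<infinity> \<Longrightarrow> \<sigma> \<le> enn2real (q x)"
  shows "(\<lambda>x. q x / ennreal \<sigma>) \<in> exponents"
proof -
  note [measurable] = exponents_measurable[OF q]
  have "1 \<le> q x / ennreal \<sigma>" for x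
  proof (cases "q x")
    case top
    then show ?thesis using \<sigma> by (simp add: ennreal_top_divide)
  next
    case (real t)
    then show ?thesis using \<sigma> le[of x] by (simp add: divide_ennreal flip: ennreal_1)
  qed
  then show ?thesis unfolding exponents_def by simp
qed

lemma unit_ball_power:
  assumes f: "f \<in> unit_ball q" and \<sigma>: "1 \<le> \<sigma>"
  shows "(\<lambda>x. f x epowr \<sigma>) \<in> unit_ball (\<lambda>x. q x / ennreal \<sigma>)"
proof -
  note [measurable] = unit_ball_measurable[OF f]
  have \<sigma>0: "0 < \<sigma>" using \<sigma> by simp
  obtain s where s: "AE x in lebesgue. q x = \<infinity> \<longrightarrow> f x \<le> s" "fin_modular q f + s \<le> 1"
    "s \<le> 1" "fin_modular q f \<le> 1"
    by (rule unit_ballE[OF f])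
  show ?thesis
  proof (rule unit_ballI[OF _ _ _ s(2)])
    show "AE x in lebesgue. q x / ennreal \<sigma> = \<infinity> \<longrightarrow> f x epowr \<sigma> \<le> s"
      using s(1)
    proof eventually_elim
      case (elim x)
      show ?case
      proof
        assume "q x / ennreal \<sigma> = \<infinity>"
        then have "f x \<le> s" using elim divide_const_eq_top_iff[OF \<sigma>0] by simp
        then show "f x epowr \<sigma> \<le> s"
          using epowr_le_self[OF order.trans[OF _ s(3)] \<sigma>] order.trans by blast
      qed
    qed
    show "fin_modular (\<lambda>x. q x / ennreal \<sigma>) (\<lambda>x. f x epowr \<sigma>) \<le> fin_modular q f"
      using \<sigma>0 unfolding fin_modular_def
      by (simp only: divide_const_eq_top_iff enn2real_divide_const epowr_epowr) simp
  qed measurable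
qed

text \<open>
  The factor $1/2$ compensates that the supremum part of the modular, unlike the integral part, is
  not invariant under the passage from $f$ to $f^\sigma$.
\<close>
lemma unit_ball_of_power:
  assumes f: "(\<lambda>x. f x epowr \<sigma>) \<in> unit_ball (\<lambda>x. q x / ennreal \<sigma>)" and \<sigma>: "1 \<le> \<sigma>" and q: "q \<in> exponents"
    and [measurable]: "f \<in> borel_measurable lebesgue"
  shows "(\<lambda>x. ennreal (1 / 2) * f x) \<in> unit_ball q"
proof -
  note [measurable] = exponents_measurable[OF q]
  have \<sigma>0: "0 < \<sigma>" using \<sigma> by simp
  obtain s where s: "AE x in lebesgue. q x / ennreal \<sigma> = \<infinity> \<longrightarrow> f x epowr \<sigma> \<le> s"
    "fin_modular (\<lambda>x. q x / ennreal \<sigma>) (\<lambda>x. f x epowr \<sigma>) + s \<le> 1"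
    "s \<le> 1" "fin_modular (\<lambda>x. q x / ennreal \<sigma>) (\<lambda>x. f x epowr \<sigma>) \<le> 1"
    by (rule unit_ballE[OF f])
  have half: "ennreal (1 / 2) + ennreal (1 / 2) \<le> 1"
    by (subst ennreal_plus[symmetric]) simp_all
  show ?thesis
  proof (rule unit_ballI[OF _ _ _ half])
    show "AE x in lebesgue. q x = \<infinity> \<longrightarrow> ennreal (1 / 2) * f x \<le> ennreal (1 / 2)"
      using s(1)
    proof eventually_elim
      case (elim x)
      show ?case
      proof
        assume "q x = \<infinity>"
        then have "f x epowr \<sigma> \<le> 1"
          using elim divide_const_eq_top_iff[OF \<sigma>0] order.trans[OF _ s(3)] by simp
        then have "(f x epowr \<sigma>) epowr (1 / \<sigma>) \<le> 1"
          by (rule epowr_le_one) (use \<sigma>0 in simp)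
        then have "f x \<le> 1" using \<sigma>0 by (simp add: epowr_epowr)
        then show "ennreal (1 / 2) * f x \<le> ennreal (1 / 2)"
          using mult_left_mono[of "f x" 1 "ennreal (1 / 2)"] by simp
      qed
    qed
    have "fin_modular q (\<lambda>x. ennreal (1 / 2) * f x) \<le> (\<integral>\<^sup>+x. ennreal (1 / 2) * (f x epowr enn2real (q x) * indicator {x. q x \<noteq> \<infinity>} x) \<partial>lebesgue)"
      unfolding fin_modular_def
    proof (rule nn_integral_mono)
      fix x
      show "(ennreal (1 / 2) * f x) epowr enn2real (q x) * indicator {x. q x \<noteq> \<infinity>} x
          \<le> ennreal (1 / 2) * (f x epowr enn2real (q x) * indicator {x. q x \<noteq> \<infinity>} x)"
        using epowr_cmult_le[of "1 / 2" "enn2real (q x)" "f x"] exponents_enn2real[OF q, of x]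
        by (cases "q x = \<infinity>") simp_all
    qed
    also have "\<dots> = ennreal (1 / 2) * fin_modular q f"
      unfolding fin_modular_def by (rule nn_integral_cmult) measurable
    also have "fin_modular q f = fin_modular (\<lambda>x. q x / ennreal \<sigma>) (\<lambda>x. f x epowr \<sigma>)"
      using \<sigma>0 unfolding fin_modular_def
      by (simp only: divide_const_eq_top_iff enn2real_divide_const epowr_epowr) simp
    also have "ennreal (1 / 2) * \<dots> \<le> ennreal (1 / 2)"
      using mult_left_mono[OF s(4), of "ennreal (1 / 2)"] by simp
    finally show "fin_modular q (\<lambda>x. ennreal (1 / 2) * f x) \<le> ennreal (1 / 2)" .
  qed measurable
qed

text \<open>
  Where $q$ is finite, $q (1 - \gamma p) = p$, so the integral part of the modular is preserved.  Where
  $q$ is infinite, the new function is $f^0 = 1$ if $\gamma > 0$ and $f$ itself if $\gamma = 0$.  The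
  factor $1/2$ makes room for the sum of both parts.
\<close>
lemma unit_ball_transfer:
  fixes p q :: "'a::euclidean_space \<Rightarrow> ennreal"
  assumes p: "p \<in> exponents" and q: "q \<in> exponents"
    and rel: "\<And>x. enn2real (1 / p x) - enn2real (1 / q x) = \<gamma>" and \<gamma>: "0 \<le> \<gamma>"
    and f: "f \<in> unit_ball p"
  shows "(\<lambda>x. ennreal (1 / 2) * f x epowr (1 - \<gamma> * enn2real (p x))) \<in> unit_ball q"
proof -
  note [measurable] = unit_ball_measurable[OF f] exponents_measurable[OF q] exponents_measurable[OF p]
  note R = exponent_relation[OF p q rel \<gamma>]
  obtain s where s: "AE x in lebesgue. p x = \<infinity> \<longrightarrow> f x \<le> s" "fin_modular p f + s \<le> 1"
    "s \<le> 1" "fin_modular p f \<le> 1"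
    by (rule unit_ballE[OF f])
  have half: "ennreal (1 / 2) + ennreal (1 / 2) \<le> 1"
    by (subst ennreal_plus[symmetric]) simp_all
  let ?g = "\<lambda>x. f x epowr (1 - \<gamma> * enn2real (p x))"
  show ?thesis
  proof (rule unit_ballI[OF _ _ _ half])
    show "AE x in lebesgue. q x = \<infinity> \<longrightarrow> ennreal (1 / 2) * ?g x \<le> ennreal (1 / 2)"
      using s(1)
    proof eventually_elim
      case (elim x)
      show ?case
      proof
        assume "q x = \<infinity>"
        then consider "p x = \<infinity>" "\<gamma> = 0" | "1 - \<gamma> * enn2real (p x) = 0"
          using R(2)[of x] by blast
        then have "?g x \<le> 1"
        proof cases
          case 1
          then show ?thesis using elim order.trans[OF _ s(3)] by simp
        qed simp
        then show "ennreal (1 / 2) * ?g x \<le> ennreal (1 / 2)"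
          using mult_left_mono[of "?g x" 1 "ennreal (1 / 2)"] by simp
      qed
    qed
    have "fin_modular q (\<lambda>x. ennreal (1 / 2) * ?g x)
        \<le> (\<integral>\<^sup>+x. ennreal (1 / 2) * (f x epowr enn2real (p x) * indicator {x. p x \<noteq> \<infinity>} x) \<partial>lebesgue)"
      unfolding fin_modular_def
    proof (rule nn_integral_mono)
      fix x
      show "(ennreal (1 / 2) * ?g x) epowr enn2real (q x) * indicator {x. q x \<noteq> \<infinity>} x
          \<le> ennreal (1 / 2) * (f x epowr enn2real (p x) * indicator {x. p x \<noteq> \<infinity>} x)"
        using epowr_cmult_le[of "1 / 2" "enn2real (q x)" "?g x"] exponents_enn2real[OF q, of x] R(1)[of x]
        by (cases "q x = \<infinity>") (simp_all add: epowr_epowr)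
    qed
    also have "\<dots> = ennreal (1 / 2) * fin_modular p f"
      unfolding fin_modular_def by (rule nn_integral_cmult) measurable
    also have "\<dots> \<le> ennreal (1 / 2)"
      using mult_left_mono[OF s(4), of "ennreal (1 / 2)"] by simp
    finally show "fin_modular q (\<lambda>x. ennreal (1 / 2) * ?g x) \<le> ennreal (1 / 2)" .
  qed measurable
qed

section \<open>The constant-exponent norms of the factored weight\<close>

text \<open>
  The choice $d = c/4$ in \<open>le_add_scaled_epowr\<close> gives the first term a contribution of at most
  $c/2$, so at least $c/2$ is left for the integral in question.
\<close>
lemma lower_bound_factored_weight:
  fixes f :: "'a::euclidean_space \<Rightarrow> ennreal"
  assumes pq: "0 < p" "0 < \<sigma>" "\<sigma> \<le> q" "1 / \<sigma> = 1 - 1 / p + 1 / q"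
    and [measurable]: "f \<in> borel_measurable lebesgue" "H \<in> borel_measurable lebesgue" "G \<in> borel_measurable lebesgue"
    and pos: "\<And>x. 0 < H x" "\<And>x. 0 < G x"
    and HG: "(\<integral>\<^sup>+x. ennreal (H x * G x) \<partial>lebesgue) \<le> 2"
    and c: "0 < c" "ennreal c \<le> (\<integral>\<^sup>+x. f x epowr \<sigma> * ennreal (G x) \<partial>lebesgue)"
  shows "ennreal ((c / 2) * (c / 4) powr (q / \<sigma> - 1))
    \<le> (\<integral>\<^sup>+x. f x epowr q * factored_weight p q H G x epowr q \<partial>lebesgue)" (is "_ \<le> ?X")
proof -
  define d where "d = c / 4"
  have d: "0 < d" using c by (simp add: d_def)
  define r where "r = q / \<sigma>"
  have r: "1 \<le> r" using pq by (simp add: r_def)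
  define z where "z = (\<lambda>x. f x epowr \<sigma> * ennreal (1 / H x))"
  have [measurable]: "z \<in> borel_measurable lebesgue" unfolding z_def by measurable
  have X: "?X = (\<integral>\<^sup>+x. ennreal (H x * G x) * z x epowr r \<partial>lebesgue)"
    unfolding z_def r_def by (intro nn_integral_cong factored_weight_left pq pos) (use pq in linarith)
  have "f x epowr \<sigma> * ennreal (G x) = ennreal (H x * G x) * z x" for x
    using pos[of x] by (simp add: z_def mult.left_commute flip: ennreal_mult)
  then have "ennreal c \<le> (\<integral>\<^sup>+x. ennreal (H x * G x) * z x \<partial>lebesgue)"
    using c(2) by simp
  also have "\<dots> \<le> (\<integral>\<^sup>+x. ennreal d * ennreal (H x * G x) + ennreal (d powr (1 - r)) * (ennreal (H x * G x) * z x epowr r) \<partial>lebesgue)"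
  proof (rule nn_integral_mono)
    fix x
    show "ennreal (H x * G x) * z x \<le> ennreal d * ennreal (H x * G x) + ennreal (d powr (1 - r)) * (ennreal (H x * G x) * z x epowr r)"
      using mult_left_mono[OF le_add_scaled_epowr[OF d r, of "z x"], of "ennreal (H x * G x)"]
      by (simp add: distrib_left mult.commute mult.left_commute)
  qed
  also have "\<dots> = ennreal d * (\<integral>\<^sup>+x. ennreal (H x * G x) \<partial>lebesgue) + ennreal (d powr (1 - r)) * ?X"
    unfolding X by (simp add: nn_integral_add nn_integral_cmult)
  also have "\<dots> \<le> ennreal d * 2 + ennreal (d powr (1 - r)) * ?X"
    using HG by (intro add_mono mult_left_mono) auto
  also have "ennreal d * 2 = ennreal (c / 2)"
    unfolding ennreal_numeral[symmetric] using d by (subst ennreal_mult[symmetric]) (auto simp: d_def)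
  finally have "ennreal (c / 2) + ennreal (c / 2) \<le> ennreal (c / 2) + ennreal (d powr (1 - r)) * ?X"
    using c by (simp flip: ennreal_plus)
  then have "ennreal (c / 2) \<le> ennreal (d powr (1 - r)) * ?X"
    by (simp add: ennreal_add_left_cancel_le)
  then have "ennreal (d powr (r - 1)) * ennreal (c / 2) \<le> ennreal (d powr (r - 1)) * (ennreal (d powr (1 - r)) * ?X)"
    by (rule mult_left_mono) simp
  also have "\<dots> = ?X"
    using d by (simp add: mult.assoc[symmetric] flip: ennreal_mult powr_add)
  finally show ?thesis
    using c by (simp add: d_def r_def mult.commute flip: ennreal_mult)
qed

lemma finite_factored_weight:
  fixes f :: "'a::euclidean_space \<Rightarrow> ennreal"
  assumes pq: "0 < p" "0 < \<sigma>" "\<sigma> \<le> q" "1 / \<sigma> = 1 - 1 / p + 1 / q"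
    and [measurable]: "H \<in> borel_measurable lebesgue" "G \<in> borel_measurable lebesgue"
    and pos: "\<And>x. 0 < H x" "\<And>x. 0 < G x"
    and HG: "(\<integral>\<^sup>+x. ennreal (H x * G x) \<partial>lebesgue) \<le> 2"
    and le: "AE x in lebesgue. f x epowr \<sigma> \<le> ennreal (E * H x)" and E: "0 < E"
  shows "(\<integral>\<^sup>+x. f x epowr q * factored_weight p q H G x epowr q \<partial>lebesgue) < \<infinity>"
proof -
  have "(\<integral>\<^sup>+x. f x epowr q * factored_weight p q H G x epowr q \<partial>lebesgue)
      \<le> (\<integral>\<^sup>+x. ennreal (E powr (q / \<sigma>)) * ennreal (H x * G x) \<partial>lebesgue)"
  proof (rule nn_integral_mono_AE)
    show "AE x in lebesgue. f x epowr q * factored_weight p q H G x epowr q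
        \<le> ennreal (E powr (q / \<sigma>)) * ennreal (H x * G x)"
      using le
    proof eventually_elim
      case (elim x)
      have "f x epowr \<sigma> * ennreal (1 / H x) \<le> ennreal (E * H x) * ennreal (1 / H x)"
        using elim by (rule mult_right_mono) simp
      also have "\<dots> = ennreal E"
        using pos[of x] E by (simp flip: ennreal_mult)
      finally have "(f x epowr \<sigma> * ennreal (1 / H x)) epowr (q / \<sigma>) \<le> ennreal E epowr (q / \<sigma>)"
        using pq by (intro epowr_mono) auto
      also have "\<dots> = ennreal (E powr (q / \<sigma>))"
        using E by (simp add: epowr_ennreal)
      finally show ?case
        using pq pos by (subst factored_weight_left[where \<sigma> = \<sigma>]) (auto simp: mult.commute[of _ "ennreal (H x * G x)"] intro!: mult_left_mono)
    qed
  qed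
  also have "\<dots> = ennreal (E powr (q / \<sigma>)) * (\<integral>\<^sup>+x. ennreal (H x * G x) \<partial>lebesgue)"
    by (rule nn_integral_cmult) measurable
  also have "\<dots> < \<infinity>"
    using le_less_trans[OF HG, of \<infinity>] by (simp add: ennreal_mult_less_top)
  finally show ?thesis .
qed

lemma upper_bound_factored_weight:
  fixes g w e :: "'a::euclidean_space \<Rightarrow> ennreal"
  assumes pq: "1 \<le> p0" "p0 \<le> q0" "0 < \<sigma>" "1 / \<sigma> = 1 - 1 / p0 + 1 / q0"
    and p: "p \<in> exponents" and p_inf: "\<And>x. p x = \<infinity> \<Longrightarrow> p0 = q0"
    and w: "w \<in> var_weights" and g: "(\<lambda>x. g x * w x) \<in> unit_ball p"
    and [measurable]: "H \<in> borel_measurable lebesgue" "G \<in> borel_measurable lebesgue"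
    and pos: "\<And>x. 0 < H x" "\<And>x. 0 < G x"
    and HG: "(\<integral>\<^sup>+x. ennreal (H x * G x) \<partial>lebesgue) \<le> 2" and E: "0 < E"
    and le: "AE x in lebesgue. ((g x * w x) epowr (1 - (1 / p0 - 1 / q0) * enn2real (p x))) epowr \<sigma>
        \<le> ennreal (E * H x) * w x epowr \<sigma>"
  shows "(\<integral>\<^sup>+x. g x epowr p0 * factored_weight p0 q0 H G x epowr p0 \<partial>lebesgue)
    \<le> ennreal (E powr (p0 / \<sigma>) * 3)"
proof -
  note [measurable] = exponents_measurable[OF p] unit_ball_measurable[OF g]
  have fin: "fin_modular p (\<lambda>x. g x * w x) \<le> 1"
    using unit_ballE[OF g] by metis
  have "(\<integral>\<^sup>+x. g x epowr p0 * factored_weight p0 q0 H G x epowr p0 \<partial>lebesgue)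
    \<le> (\<integral>\<^sup>+x. ennreal (E powr (p0 / \<sigma>)) *
        ((g x * w x) epowr enn2real (p x) * indicator {x. p x \<noteq> \<infinity>} x + ennreal (H x * G x)) \<partial>lebesgue)"
  proof (rule nn_integral_mono_AE)
    show "AE x in lebesgue. g x epowr p0 * factored_weight p0 q0 H G x epowr p0
      \<le> ennreal (E powr (p0 / \<sigma>)) *
        ((g x * w x) epowr enn2real (p x) * indicator {x. p x \<noteq> \<infinity>} x + ennreal (H x * G x))"
      using le var_weights_AE[OF w] unit_ball_finite[OF g p]
    proof eventually_elim
      case (elim x)
      have P: "enn2real (p x) = 0 \<longleftrightarrow> p x = \<infinity>"
        by (cases "p x = \<infinity>") (use exponents_enn2real[OF p, of x] in simp_all)
      have "g x epowr p0 * factored_weight p0 q0 H G x epowr p0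
        \<le> ennreal (E powr (p0 / \<sigma>)) *
          ((if enn2real (p x) = 0 then 0 else (g x * w x) epowr enn2real (p x)) + ennreal (H x * G x))"
        using elim pos E p_inf[of x] pq P by (intro factored_weight_right) auto
      then show ?case
        unfolding P by (cases "p x = \<infinity>") simp_all
    qed
  qed
  also have "\<dots> = ennreal (E powr (p0 / \<sigma>)) *
      (fin_modular p (\<lambda>x. g x * w x) + (\<integral>\<^sup>+x. ennreal (H x * G x) \<partial>lebesgue))"
    unfolding fin_modular_def by (simp add: nn_integral_cmult nn_integral_add)
  also have "\<dots> \<le> ennreal (E powr (p0 / \<sigma>)) * (1 + 2)"
    by (intro mult_left_mono add_mono fin HG) simp
  also have "\<dots> = ennreal (E powr (p0 / \<sigma>) * 3)"
    by (simp add: ennreal_mult)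
  finally show ?thesis .
qed

section \<open>Extrapolation\<close>

text \<open>
  The counterpart of \<open>Rubio_de_Francia\<close> for $p_0 = 1$, where \<open>H\<close> has exponent $0$ in the weight and is
  only used for comparison.
\<close>
lemma trivial_majorant:
  fixes v :: "'a::euclidean_space \<Rightarrow> ennreal"
  assumes r: "r \<in> exponents" and v: "v \<in> var_weights"
    and S: "S \<in> unit_ball r" and pos: "\<And>x. 0 < S x"
  obtains H :: "'a \<Rightarrow> real" where "H \<in> borel_measurable lebesgue" "\<And>x. 0 < H x"
    "(\<lambda>x. ennreal (H x) * v x) \<in> unit_ball r" "AE x in lebesgue. S x \<le> ennreal (H x) * v x"
proof -
  note [measurable] = unit_ball_measurable[OF S] var_weights_measurable[OF v]
  define H where "H = (\<lambda>x. if 0 < S x / v x \<and> S x / v x < \<infinity> then enn2real (S x / v x) else 1)"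
  have [measurable]: "H \<in> borel_measurable lebesgue" unfolding H_def by measurable
  have H_pos: "0 < H x" for x by (auto simp: H_def enn2real_positive_iff)
  have eq: "AE x in lebesgue. ennreal (H x) * v x = S x"
    using var_weights_AE[OF v] unit_ball_finite[OF S r]
  proof eventually_elim
    case (elim x)
    have "S x / v x < \<infinity>" "S x / v x \<noteq> 0"
      using elim pos[of x] by (auto simp: ennreal_divide_eq_top_iff ennreal_divide_eq_0_iff less_top[symmetric])
    then have "ennreal (H x) = S x / v x"
      by (simp add: H_def zero_less_iff_neq_zero)
    then show ?case using elim by (simp add: ennreal_divide_mult_cancel)
  qed
  then have "(\<lambda>x. ennreal (H x) * v x) \<in> unit_ball r"
    by (intro unit_ball_mono[OF S]) (auto elim: eventually_mono)
  moreover have "AE x in lebesgue. S x \<le> ennreal (H x) * v x"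
    using eq by (auto elim: eventually_mono)
  ultimately show thesis using H_pos by (intro that[of H]) auto
qed

lemma epowr_var_weights:
  assumes w: "w \<in> var_weights"
  shows "(\<lambda>x. w x epowr a) \<in> var_weights"
proof -
  note [measurable] = var_weights_measurable[OF w]
  have "AE x in lebesgue. 0 < w x epowr a \<and> w x epowr a < \<infinity>"
    using var_weights_AE[OF w]
  proof eventually_elim
    case (elim x)
    then show ?case
      by (cases "w x" rule: ennreal_pos_cases) (auto simp: epowr_ennreal)
  qed
  then show ?thesis by (simp add: var_weights_def)
qed

lemma epowr_minus_cancel:
  assumes "0 < w" "w < \<infinity>"
  shows "w epowr a * w epowr (- a) = 1"
proof -
  obtain t where t: "w = ennreal t" "0 < t"
    using assms by (cases w rule: ennreal_pos_cases) auto
  then show ?thesis by (simp add: epowr_ennreal powr_minus field_simps flip: ennreal_mult)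
qed

text \<open>
  The core of the proof.  The functions $f_k w$ and $u_k w = (g_k w)^{1-\gamma p}$ lie, up to
  constants, in the unit ball for $q$; \<open>S\<close> dominates all of them, and \<open>H\<close> dominates $S^\sigma/w^\sigma$.
  On the dual side, $b_k$ norms the function $(8 f_k w)^\sigma$, \<open>T\<close> dominates all $b_k$, and \<open>G\<close>
  dominates $T w^\sigma$.  Since $Hw^\sigma$ and $Gw^{-\sigma}$ lie in dual unit balls, $\int HG \le 2$, and the
  lemmas of the previous section apply to each pair.  The constants $D_k$ are fixed before the
  sequences are given, so that a sequence of counterexamples can be chosen in terms of them.
\<close>
lemma extrapolation_weight:
  fixes p q w :: "'a::euclidean_space \<Rightarrow> ennreal" and p0 q0 \<sigma> :: real
  assumes p0q0: "1 \<le> p0" "p0 \<le> q0" and \<sigma>: "1 \<le> \<sigma>" "1 / \<sigma> = 1 - (1 / p0 - 1 / q0)"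
    and p: "p \<in> exponents" and q: "q \<in> exponents"
    and rel: "\<And>x. enn2real (1 / p x) - enn2real (1 / q x) = 1 / p0 - 1 / q0"
    and w: "w \<in> var_weights"
    and M1: "1 < p0 \<Longrightarrow> maximal_bounded (\<lambda>x. q x / ennreal \<sigma>) (\<lambda>x. w x epowr \<sigma>)"
    and M2: "maximal_bounded (\<lambda>x. conj_exp (q x / ennreal \<sigma>)) (\<lambda>x. w x epowr (- \<sigma>))"
  obtains D :: "nat \<Rightarrow> real" where "\<And>k. 0 < D k"
    "\<And>f g. \<lbrakk>\<And>k. f k \<in> borel_measurable lebesgue;
        \<And>k. (\<lambda>x. f k x * w x) \<in> unit_ball q; \<And>k. (\<lambda>x. 4 * (f k x * w x)) \<notin> unit_ball q;
        \<And>k. (\<lambda>x. g k x * w x) \<in> unit_ball p\<rbrakk> \<Longrightarrow>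
      \<exists>w0\<in>A_const p0 q0. \<forall>k.
        0 < (\<integral>\<^sup>+x. f k x epowr q0 * w0 x epowr q0 \<partial>lebesgue) \<and>
        (\<integral>\<^sup>+x. f k x epowr q0 * w0 x epowr q0 \<partial>lebesgue) < \<infinity> \<and>
        (\<integral>\<^sup>+x. g k x epowr p0 * w0 x epowr p0 \<partial>lebesgue) epowr (1 / p0)
          \<le> ennreal (D k) * (\<integral>\<^sup>+x. f k x epowr q0 * w0 x epowr q0 \<partial>lebesgue) epowr (1 / q0)"
proof -
  note [measurable] = exponents_measurable[OF p] exponents_measurable[OF q] var_weights_measurable[OF w]
  define \<gamma> where "\<gamma> = 1 / p0 - 1 / q0"
  have \<gamma>: "0 \<le> \<gamma>" using p0q0 by (simp add: \<gamma>_def field_simps)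
  have rel': "enn2real (1 / p x) - enn2real (1 / q x) = \<gamma>" for x
    using rel by (simp add: \<gamma>_def)
  note R = exponent_relation[OF p q rel' \<gamma>]
  have \<sigma>0: "0 < \<sigma>" using \<sigma> by simp
  have pos0: "0 < p0" "0 < q0" using p0q0 by auto
  have \<sigma>_eq: "1 / \<sigma> = 1 - 1 / p0 + 1 / q0" using \<sigma> by simp
  have \<sigma>_q0: "\<sigma> \<le> q0"
  proof -
    have "1 / q0 \<le> 1 / \<sigma>" unfolding \<sigma>_eq using p0q0 by simp
    then show ?thesis using le_imp_inverse_le[of "1 / q0" "1 / \<sigma>"] pos0 by simp
  qed
  let ?r = "\<lambda>x. q x / ennreal \<sigma>"
  let ?v = "\<lambda>x. w x epowr \<sigma>"
  let ?u = "\<lambda>x. w x epowr (- \<sigma>)"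
  have r: "?r \<in> exponents"
    by (rule divide_exponents[OF q \<sigma>0]) (use R(5)[OF \<sigma>0] \<sigma> in \<open>simp add: \<gamma>_def\<close>)
  have r': "(\<lambda>x. conj_exp (?r x)) \<in> exponents" by (rule conj_exp_exponents[OF r])
  have v: "?v \<in> var_weights" by (rule epowr_var_weights[OF w])
  have u: "?u \<in> var_weights" by (rule epowr_var_weights[OF w])
  note [measurable] = var_weights_measurable[OF v] var_weights_measurable[OF u]
  obtain K :: real where K: "0 < K"
    "\<And>S. S \<in> unit_ball ?r \<Longrightarrow> (\<And>x. 0 < S x) \<Longrightarrow>
      \<exists>H. H \<in> borel_measurable lebesgue \<and> (\<forall>x. 0 < H x) \<and> (1 < p0 \<longrightarrow> A_one K H) \<and>
          (\<lambda>x. ennreal (H x) * ?v x) \<in> unit_ball ?r \<and>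
          (AE x in lebesgue. S x \<le> ennreal (K * H x) * ?v x)"
  proof (cases "p0 = 1")
    case True
    show thesis
    proof (rule that[of 1])
      fix S :: "'a \<Rightarrow> ennreal" assume S: "S \<in> unit_ball ?r" "\<And>x. 0 < S x"
      obtain H :: "'a \<Rightarrow> real" where "H \<in> borel_measurable lebesgue" "\<And>x. 0 < H x"
        "(\<lambda>x. ennreal (H x) * ?v x) \<in> unit_ball ?r" "AE x in lebesgue. S x \<le> ennreal (H x) * ?v x"
        by (rule trivial_majorant[OF r v S]) blast
      then show "\<exists>H. H \<in> borel_measurable lebesgue \<and> (\<forall>x. 0 < H x) \<and> (1 < p0 \<longrightarrow> A_one 1 H) \<and>
          (\<lambda>x. ennreal (H x) * ?v x) \<in> unit_ball ?r \<and>
          (AE x in lebesgue. S x \<le> ennreal (1 * H x) * ?v x)"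
        using True by (intro exI[of _ H]) simp
    qed simp
  next
    case False
    then have "1 < p0" using p0q0 by simp
    obtain K :: real where "0 < K"
      "\<And>S. S \<in> unit_ball ?r \<Longrightarrow> (\<And>x. 0 < S x) \<Longrightarrow>
      \<exists>H. H \<in> borel_measurable lebesgue \<and> (\<forall>x. 0 < H x) \<and> A_one K H \<and>
          (\<lambda>x. ennreal (H x) * ?v x) \<in> unit_ball ?r \<and>
          (AE x in lebesgue. S x \<le> ennreal (K * H x) * ?v x)"
      by (rule Rubio_de_Francia[OF M1[OF \<open>1 < p0\<close>] r v]) blast
    then show thesis by (intro that[of K]) blast+
  qed
  obtain L :: real where L: "0 < L"
    "\<And>S. S \<in> unit_ball (\<lambda>x. conj_exp (?r x)) \<Longrightarrow> (\<And>x. 0 < S x) \<Longrightarrow>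
      \<exists>H. H \<in> borel_measurable lebesgue \<and> (\<forall>x. 0 < H x) \<and> A_one L H \<and>
          (\<lambda>x. ennreal (H x) * ?u x) \<in> unit_ball (\<lambda>x. conj_exp (?r x)) \<and>
          (AE x in lebesgue. S x \<le> ennreal (L * H x) * ?u x)"
    by (rule Rubio_de_Francia[OF M2 r' u]) blast
  \<comment> \<open>\<open>E k\<close> bounds $f_k^\sigma$ and $u_k^\sigma$ in terms of $H$, and \<open>N k\<close> bounds $(8 f_k w)^\sigma b_k$ in terms of
    $f_k^\sigma G$; hence \<open>c k\<close> is a lower bound for the integral of $f_k^\sigma G$, and \<open>l k\<close> one for the integral
    of $f_k^{q_0} w_0^{q_0}$.  The numerator of \<open>D k\<close> is the upper bound for the norm of $g_k$.\<close>
  define E where "E k = (4 ^ (2 * k + 4)) powr \<sigma> * K" for k :: nat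
  define N where "N k = 8 powr \<sigma> * (4 ^ (k + 2) * L)" for k :: nat
  define c where "c k = 1 / 4 / N k" for k
  define l where "l k = (c k / 2) * (c k / 4) powr (q0 / \<sigma> - 1)" for k
  define D where "D k = (E k powr (p0 / \<sigma>) * 3) powr (1 / p0) / l k powr (1 / q0)" for k
  have E: "0 < E k" and N: "0 < N k" and c: "0 < c k" and l: "0 < l k" for k
  proof -
    show "0 < E k" using K by (simp add: E_def)
    show "0 < N k" using L by (simp add: N_def)
    then show "0 < c k" by (simp add: c_def)
    then show "0 < l k" by (simp add: l_def)
  qed
  show thesis
  proof (rule that[of D])
    show "0 < D k" for k using E[of k] l[of k] by (simp add: D_def)
    fix f g :: "nat \<Rightarrow> 'a \<Rightarrow> ennreal"
    assume f[measurable]: "\<And>k. f k \<in> borel_measurable lebesgue"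
      and f_unit: "\<And>k. (\<lambda>x. f k x * w x) \<in> unit_ball q"
      and f_not: "\<And>k. (\<lambda>x. 4 * (f k x * w x)) \<notin> unit_ball q"
      and g_unit: "\<And>k. (\<lambda>x. g k x * w x) \<in> unit_ball p"
    define y where "y k x = (g k x * w x) epowr (1 - \<gamma> * enn2real (p x))" for k x
    have y_unit: "(\<lambda>x. ennreal (1 / 2) * y k x) \<in> unit_ball q" for k
      unfolding y_def by (rule unit_ball_transfer[OF p q rel' \<gamma> g_unit])
    \<comment> \<open>Interleave the two sequences, so that one majorant serves both.\<close>
    define a where "a j = (if even j then (\<lambda>x. f (j div 2) x * w x) else (\<lambda>x. ennreal (1 / 2) * y (j div 2) x))" for j :: nat
    have "a j \<in> unit_ball q" for j
      using f_unit y_unit by (simp add: a_def del: ennreal_half)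
    then obtain S where S: "S \<in> unit_ball q" "\<And>x. 0 < S x" "\<And>k x. a k x \<le> ennreal (4 ^ (k + 2)) * S x"
      by (rule unit_ball_majorant[OF q, of a]) blast
    have f_S: "f k x * w x \<le> ennreal (4 ^ (2 * k + 4)) * S x" for k x
    proof -
      have "f k x * w x \<le> ennreal (4 ^ (2 * k + 2)) * S x"
        using S(3)[of "2 * k" x] by (simp add: a_def)
      also have "\<dots> \<le> ennreal (4 ^ (2 * k + 4)) * S x"
        by (intro mult_right_mono ennreal_leI power_increasing) auto
      finally show ?thesis .
    qed
    have y_S: "y k x \<le> ennreal (4 ^ (2 * k + 4)) * S x" for k x
    proof -
      have "ennreal (1 / 2) * y k x \<le> ennreal (4 ^ (2 * k + 3)) * S x"
        using S(3)[of "2 * k + 1" x] by (simp add: a_def numeral_3_eq_3 del: ennreal_half)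
      then have "ennreal 2 * (ennreal (1 / 2) * y k x) \<le> ennreal 2 * (ennreal (4 ^ (2 * k + 3)) * S x)"
        by (rule mult_left_mono) simp
      also have "ennreal 2 * (ennreal (1 / 2) * y k x) = y k x"
        unfolding mult.assoc[symmetric] by (subst ennreal_mult[symmetric]) auto
      also have "ennreal 2 * (ennreal (4 ^ (2 * k + 3)) * S x) = ennreal (2 * 4 ^ (2 * k + 3)) * S x"
        by (subst ennreal_mult) (auto simp: mult.assoc)
      also have "\<dots> \<le> ennreal (4 ^ (2 * k + 4)) * S x"
        by (intro mult_right_mono ennreal_leI) (auto simp: power_add)
      finally show ?thesis .
    qed
    have "(\<lambda>x. S x epowr \<sigma>) \<in> unit_ball ?r" by (rule unit_ball_power[OF S(1) \<sigma>(1)])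
    moreover have "0 < S x epowr \<sigma>" for x
      using S(2)[of x] epowr_eq_0[OF \<sigma>0, of "S x"] by (simp add: zero_less_iff_neq_zero)
    ultimately obtain H where H[measurable]: "H \<in> borel_measurable lebesgue" and H_pos: "\<And>x. 0 < H x"
      and H_A: "1 < p0 \<Longrightarrow> A_one K H" and H_unit: "(\<lambda>x. ennreal (H x) * ?v x) \<in> unit_ball ?r"
      and S_H: "AE x in lebesgue. S x epowr \<sigma> \<le> ennreal (K * H x) * ?v x"
      using K(2)[of "\<lambda>x. S x epowr \<sigma>"] by blast
    have pow_H: "AE x in lebesgue. \<forall>z k. z \<le> ennreal (4 ^ (2 * k + 4)) * S x \<longrightarrow> z epowr \<sigma> \<le> ennreal (E k * H x) * ?v x"
      using S_H
    proof eventually_elim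
      case (elim x)
      show ?case
      proof (intro allI impI)
        fix z k assume "z \<le> ennreal (4 ^ (2 * k + 4)) * S x"
        then have "z epowr \<sigma> \<le> (ennreal (4 ^ (2 * k + 4)) * S x) epowr \<sigma>"
          using \<sigma>0 by (intro epowr_mono) auto
        also have "\<dots> = ennreal ((4 ^ (2 * k + 4)) powr \<sigma>) * S x epowr \<sigma>"
          using \<sigma>0 by (simp only: epowr_mult less_imp_le) (subst epowr_ennreal, simp_all)
        also have "\<dots> \<le> ennreal ((4 ^ (2 * k + 4)) powr \<sigma>) * (ennreal (K * H x) * ?v x)"
          by (intro mult_left_mono elim) simp
        also have "\<dots> = ennreal (E k * H x) * ?v x"
          using K H_pos[of x] by (simp add: E_def mult.assoc ennreal_mult)
        finally show "z epowr \<sigma> \<le> ennreal (E k * H x) * ?v x" .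
      qed
    qed
    have "\<exists>b. b \<in> unit_ball (\<lambda>x. conj_exp (?r x)) \<and>
        ennreal (1 / 4) \<le> (\<integral>\<^sup>+x. (8 * (f k x * w x)) epowr \<sigma> * b x \<partial>lebesgue)" for k
    proof -
      \<comment> \<open>The factor 8 instead of 4 makes up for the loss of 1/2 in \<open>unit_ball_of_power\<close>.\<close>
      let ?F = "\<lambda>x. (8 * (f k x * w x)) epowr \<sigma>"
      have "?F \<notin> unit_ball ?r"
      proof
        assume "?F \<in> unit_ball ?r"
        then have "(\<lambda>x. ennreal (1 / 2) * (8 * (f k x * w x))) \<in> unit_ball q"
          by (rule unit_ball_of_power[OF _ \<sigma>(1) q]) measurable
        moreover have "ennreal (1 / 2) * (8 * z) = 4 * z" for z
          unfolding mult.assoc[symmetric] ennreal_numeral[symmetric] by (subst ennreal_mult[symmetric]) auto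
        ultimately show False using f_not[of k] by simp
      qed
      moreover have "AE x in lebesgue. ?F x < \<infinity>"
        using unit_ball_finite[OF f_unit[of k] q]
      proof eventually_elim
        case (elim x)
        have "8 * z \<noteq> \<infinity>" if "z < \<infinity>" for z :: ennreal
          using that by (simp add: ennreal_mult_eq_top_iff)
        then have "8 * (f k x * w x) \<noteq> \<infinity>" using elim by blast
        then have "(8 * (f k x * w x)) epowr \<sigma> \<noteq> \<infinity>" by (subst epowr_eq_top[OF \<sigma>0])
        then show ?case unfolding less_top infinity_ennreal_def .
      qed
      moreover have "?F \<in> borel_measurable lebesgue" by measurable
      ultimately show ?thesis
        by (elim norming_function[OF r, rotated 2]) blast
    qed
    then have "\<forall>k. \<exists>b. b \<in> unit_ball (\<lambda>x. conj_exp (?r x)) \<and>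
        ennreal (1 / 4) \<le> (\<integral>\<^sup>+x. (8 * (f k x * w x)) epowr \<sigma> * b x \<partial>lebesgue)" by (rule allI)
    from choice[OF this] obtain b where "\<forall>k. b k \<in> unit_ball (\<lambda>x. conj_exp (?r x)) \<and>
        ennreal (1 / 4) \<le> (\<integral>\<^sup>+x. (8 * (f k x * w x)) epowr \<sigma> * b k x \<partial>lebesgue)" ..
    then have b: "b k \<in> unit_ball (\<lambda>x. conj_exp (?r x))"
      "ennreal (1 / 4) \<le> (\<integral>\<^sup>+x. (8 * (f k x * w x)) epowr \<sigma> * b k x \<partial>lebesgue)" for k
      by (simp_all only:)
    obtain T where T: "T \<in> unit_ball (\<lambda>x. conj_exp (?r x))" "\<And>x. 0 < T x"
      "\<And>k x. b k x \<le> ennreal (4 ^ (k + 2)) * T x"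
      by (rule unit_ball_majorant[OF r', of b, OF b(1)]) blast
    obtain G where G[measurable]: "G \<in> borel_measurable lebesgue" and G_pos: "\<And>x. 0 < G x"
      and G_A: "A_one L G" and G_unit: "(\<lambda>x. ennreal (G x) * ?u x) \<in> unit_ball (\<lambda>x. conj_exp (?r x))"
      and T_G: "AE x in lebesgue. T x \<le> ennreal (L * G x) * ?u x"
      using L(2)[OF T(1,2)] by blast
    have HG: "(\<integral>\<^sup>+x. ennreal (H x * G x) \<partial>lebesgue) \<le> 2"
    proof -
      have "(\<integral>\<^sup>+x. ennreal (H x * G x) \<partial>lebesgue)
          = (\<integral>\<^sup>+x. (ennreal (H x) * ?v x) * (ennreal (G x) * ?u x) \<partial>lebesgue)"
      proof (rule nn_integral_cong_AE)
        show "AE x in lebesgue. ennreal (H x * G x) = (ennreal (H x) * ?v x) * (ennreal (G x) * ?u x)"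
          using var_weights_AE[OF w]
        proof eventually_elim
          case (elim x)
          have "(ennreal (H x) * ?v x) * (ennreal (G x) * ?u x) = ennreal (H x) * ennreal (G x) * (?v x * ?u x)"
            by (simp add: mult_ac)
          then show ?case
            using elim H_pos[of x] G_pos[of x] by (simp add: epowr_minus_cancel ennreal_mult)
        qed
      qed
      also have "\<dots> \<le> 2" by (rule Holder_unit_ball[OF r H_unit G_unit])
      finally show ?thesis .
    qed
    let ?w0 = "factored_weight p0 q0 H G"
    have "?w0 \<in> A_const p0 q0"
    proof (cases "p0 = 1")
      case True
      then show ?thesis
        using factored_weight_A_const_one[OF pos0(2) H H_pos G G_pos G_A L(1)] by simp
    next
      case False
      then have "1 < p0" using p0q0 by simp
      then show ?thesis
        by (intro factored_weight_A_const[OF _ pos0(2) H H_pos H_A K(1) G G_pos G_A L(1)])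
    qed
    moreover have "\<forall>k. 0 < (\<integral>\<^sup>+x. f k x epowr q0 * ?w0 x epowr q0 \<partial>lebesgue) \<and>
        (\<integral>\<^sup>+x. f k x epowr q0 * ?w0 x epowr q0 \<partial>lebesgue) < \<infinity> \<and>
        (\<integral>\<^sup>+x. g k x epowr p0 * ?w0 x epowr p0 \<partial>lebesgue) epowr (1 / p0)
          \<le> ennreal (D k) * (\<integral>\<^sup>+x. f k x epowr q0 * ?w0 x epowr q0 \<partial>lebesgue) epowr (1 / q0)"
    proof
      fix k
      let ?X = "\<integral>\<^sup>+x. f k x epowr q0 * ?w0 x epowr q0 \<partial>lebesgue"
      let ?Y = "\<integral>\<^sup>+x. g k x epowr p0 * ?w0 x epowr p0 \<partial>lebesgue"
      have "AE x in lebesgue. f k x epowr \<sigma> \<le> ennreal (E k * H x)"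
        using pow_H var_weights_AE[OF w]
      proof eventually_elim
        case (elim x)
        have "(f k x * w x) epowr \<sigma> \<le> ennreal (E k * H x) * ?v x"
          using elim(1) f_S by blast
        then have "(f k x * w x) epowr \<sigma> * ?u x \<le> ennreal (E k * H x) * ?v x * ?u x"
          by (rule mult_right_mono) simp
        then show ?case
          using elim(2) \<sigma>0 by (simp add: epowr_mult mult.assoc epowr_minus_cancel)
      qed
      then have X_fin: "?X < \<infinity>"
        by (rule finite_factored_weight[OF pos0(1) \<sigma>0 \<sigma>_q0 \<sigma>_eq H G H_pos G_pos HG _ E])
      have "ennreal (1 / 4) \<le> (\<integral>\<^sup>+x. (8 * (f k x * w x)) epowr \<sigma> * b k x \<partial>lebesgue)"
        by (rule b(2))
      also have "\<dots> \<le> (\<integral>\<^sup>+x. ennreal (N k) * (f k x epowr \<sigma> * ennreal (G x)) \<partial>lebesgue)"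
      proof (rule nn_integral_mono_AE)
        show "AE x in lebesgue. (8 * (f k x * w x)) epowr \<sigma> * b k x
            \<le> ennreal (N k) * (f k x epowr \<sigma> * ennreal (G x))"
          using T_G var_weights_AE[OF w]
        proof eventually_elim
          case (elim x)
          have 8: "(8 * (f k x * w x)) epowr \<sigma> = ennreal (8 powr \<sigma>) * (f k x epowr \<sigma> * ?v x)"
            using \<sigma>0 epowr_ennreal[of 8 \<sigma>] by (simp add: epowr_mult)
          have "b k x \<le> ennreal (4 ^ (k + 2)) * (ennreal (L * G x) * ?u x)"
            by (rule order.trans[OF T(3) mult_left_mono[OF elim(1)]]) simp
          then have "(8 * (f k x * w x)) epowr \<sigma> * b k x
              \<le> ennreal (8 powr \<sigma>) * (f k x epowr \<sigma> * ?v x) * (ennreal (4 ^ (k + 2)) * (ennreal (L * G x) * ?u x))"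
            unfolding 8 by (rule mult_left_mono) simp
          also have "\<dots> = ennreal (8 powr \<sigma>) * (ennreal (4 ^ (k + 2)) * ennreal (L * G x)) * f k x epowr \<sigma> * (?v x * ?u x)"
            by (simp only: mult_ac)
          also have "?v x * ?u x = 1" using elim(2) by (simp add: epowr_minus_cancel)
          also have "ennreal (8 powr \<sigma>) * (ennreal (4 ^ (k + 2)) * ennreal (L * G x)) = ennreal (N k) * ennreal (G x)"
            using L(1) G_pos[of x] by (simp only: ennreal_mult[symmetric] N_def mult.assoc) (simp add: ennreal_mult less_imp_le mult.assoc)
          finally show ?case by (simp add: mult_ac)
        qed
      qed
      also have "\<dots> = ennreal (N k) * (\<integral>\<^sup>+x. f k x epowr \<sigma> * ennreal (G x) \<partial>lebesgue)"
        by (rule nn_integral_cmult) measurable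
      finally have "ennreal (1 / N k) * ennreal (1 / 4)
          \<le> ennreal (1 / N k) * (ennreal (N k) * (\<integral>\<^sup>+x. f k x epowr \<sigma> * ennreal (G x) \<partial>lebesgue))"
        by (rule mult_left_mono) simp
      also have "ennreal (1 / N k) * ennreal (1 / 4) = ennreal (c k)"
        using N[of k] unfolding c_def by (subst ennreal_mult[symmetric]) auto
      also have "ennreal (1 / N k) * (ennreal (N k) * (\<integral>\<^sup>+x. f k x epowr \<sigma> * ennreal (G x) \<partial>lebesgue))
          = (\<integral>\<^sup>+x. f k x epowr \<sigma> * ennreal (G x) \<partial>lebesgue)"
        using N[of k] unfolding mult.assoc[symmetric] by (subst ennreal_mult[symmetric]) auto
      finally have X_ge: "ennreal (l k) \<le> ?X"
        unfolding l_def
        by (rule lower_bound_factored_weight[OF pos0(1) \<sigma>0 \<sigma>_q0 \<sigma>_eq f H G H_pos G_pos HG c])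
      then have X_pos: "0 < ?X"
        using l[of k] by (intro less_le_trans[OF _ X_ge]) simp
      have "AE x in lebesgue. ((g k x * w x) epowr (1 - (1 / p0 - 1 / q0) * enn2real (p x))) epowr \<sigma>
          \<le> ennreal (E k * H x) * w x epowr \<sigma>"
        using pow_H
      proof eventually_elim
        case (elim x)
        have "y k x epowr \<sigma> \<le> ennreal (E k * H x) * ?v x" using elim y_S by blast
        then show ?case by (simp add: y_def \<gamma>_def)
      qed
      moreover have "p0 = q0" if "p x = \<infinity>" for x
        using R(4)[OF that] pos0 by (simp add: \<gamma>_def)
      ultimately have Y_le: "?Y \<le> ennreal (E k powr (p0 / \<sigma>) * 3)"
        using H_pos G_pos
        by (intro upper_bound_factored_weight[OF p0q0 \<sigma>0 \<sigma>_eq p _ w g_unit H G _ _ HG E])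
      have "?Y epowr (1 / p0) \<le> ennreal (E k powr (p0 / \<sigma>) * 3) epowr (1 / p0)"
        using pos0 by (intro epowr_mono Y_le) simp
      also have "\<dots> = ennreal (D k * l k powr (1 / q0))"
        using E[of k] l[of k] by (subst epowr_ennreal) (simp_all add: D_def)
      also have "\<dots> = ennreal (D k) * ennreal (l k) epowr (1 / q0)"
      proof -
        have "0 \<le> D k" using E[of k] l[of k] by (simp add: D_def)
        then show ?thesis using l[of k] by (simp add: epowr_ennreal ennreal_mult)
      qed
      also have "\<dots> \<le> ennreal (D k) * ?X epowr (1 / q0)"
        using pos0 by (intro mult_left_mono epowr_mono X_ge) simp_all
      finally show "0 < ?X \<and> ?X < \<infinity> \<and> ?Y epowr (1 / p0) \<le> ennreal (D k) * ?X epowr (1 / q0)"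
        using X_pos X_fin by blast
    qed
    ultimately show "\<exists>w0\<in>A_const p0 q0. \<forall>k.
        0 < (\<integral>\<^sup>+x. f k x epowr q0 * w0 x epowr q0 \<partial>lebesgue) \<and>
        (\<integral>\<^sup>+x. f k x epowr q0 * w0 x epowr q0 \<partial>lebesgue) < \<infinity> \<and>
        (\<integral>\<^sup>+x. g k x epowr p0 * w0 x epowr p0 \<partial>lebesgue) epowr (1 / p0)
          \<le> ennreal (D k) * (\<integral>\<^sup>+x. f k x epowr q0 * w0 x epowr q0 \<partial>lebesgue) epowr (1 / q0)"
      by blast
  qed
qed

lemma scaled_power_integral:
  assumes "0 < a" "0 < c" and [measurable]: "f \<in> borel_measurable lebesgue" "h \<in> borel_measurable lebesgue"
  shows "(\<integral>\<^sup>+x. (ennreal c * f x) epowr a * h x epowr a \<partial>lebesgue) epowr (1 / a)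
    = ennreal c * (\<integral>\<^sup>+x. f x epowr a * h x epowr a \<partial>lebesgue) epowr (1 / a)"
proof -
  have "(\<integral>\<^sup>+x. (ennreal c * f x) epowr a * h x epowr a \<partial>lebesgue)
      = (\<integral>\<^sup>+x. ennreal (c powr a) * (f x epowr a * h x epowr a) \<partial>lebesgue)"
    using assms(1,2) by (simp add: epowr_mult epowr_ennreal mult.assoc)
  also have "\<dots> = ennreal (c powr a) * (\<integral>\<^sup>+x. f x epowr a * h x epowr a \<partial>lebesgue)"
    by (rule nn_integral_cmult) measurable
  finally show ?thesis
    using assms(1,2) by (simp add: epowr_mult epowr_ennreal powr_powr)
qed

text \<open>
  Both parts of the theorem at once.  If no constant works, there are pairs $(f_k, g_k)$ with
  $\|f_k\| > (k+1) D_k \|g_k\|$, where $D_k$ comes from \<open>extrapolation_weight\<close>.  After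
  normalisation, the weight of that lemma turns the hypothesis for this one weight into
  $2(k+1) \le C_0$ for all $k$.
\<close>
lemma extrapolation:
  fixes F :: "(('a::euclidean_space \<Rightarrow> ennreal) \<times> ('a \<Rightarrow> ennreal)) set"
    and p q w :: "'a \<Rightarrow> ennreal" and p0 q0 \<sigma> :: real
  assumes F: "F \<subseteq> borel_measurable lebesgue \<times> borel_measurable lebesgue"
    and p0q0: "1 \<le> p0" "p0 \<le> q0"
    and hyp: "\<And>w0. w0 \<in> A_const p0 q0 \<Longrightarrow> family_ineq F
        (\<lambda>f. (\<integral>\<^sup>+x. f x epowr q0 * w0 x epowr q0 \<partial>lebesgue) epowr (1 / q0))
        (\<lambda>g. (\<integral>\<^sup>+x. g x epowr p0 * w0 x epowr p0 \<partial>lebesgue) epowr (1 / p0))"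
    and \<sigma>: "1 \<le> \<sigma>" "1 / \<sigma> = 1 - (1 / p0 - 1 / q0)"
    and p: "p \<in> exponents" and q: "q \<in> exponents"
    and rel: "\<And>x. enn2real (1 / p x) - enn2real (1 / q x) = 1 / p0 - 1 / q0"
    and w: "w \<in> var_weights"
    and M1: "1 < p0 \<Longrightarrow> maximal_bounded (\<lambda>x. q x / ennreal \<sigma>) (\<lambda>x. w x epowr \<sigma>)"
    and M2: "maximal_bounded (\<lambda>x. conj_exp (q x / ennreal \<sigma>)) (\<lambda>x. w x epowr (- \<sigma>))"
  shows "family_ineq F (weighted_norm q w) (weighted_norm p w)"
proof (rule ccontr)
  assume contra: "\<not> family_ineq F (weighted_norm q w) (weighted_norm p w)"
  note [measurable] = var_weights_measurable[OF w]
  have pos0: "0 < p0" "0 < q0" using p0q0 by auto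
  show False
  proof (rule extrapolation_weight[OF p0q0 \<sigma> p q rel w M1 M2])
    fix D :: "nat \<Rightarrow> real"
    assume D: "\<And>k. 0 < D k"
      and weight: "\<And>f g. \<lbrakk>\<And>k. f k \<in> borel_measurable lebesgue;
          \<And>k. (\<lambda>x. f k x * w x) \<in> unit_ball q; \<And>k. (\<lambda>x. 4 * (f k x * w x)) \<notin> unit_ball q;
          \<And>k. (\<lambda>x. g k x * w x) \<in> unit_ball p\<rbrakk> \<Longrightarrow>
        \<exists>w0\<in>A_const p0 q0. \<forall>k.
          0 < (\<integral>\<^sup>+x. f k x epowr q0 * w0 x epowr q0 \<partial>lebesgue) \<and>
          (\<integral>\<^sup>+x. f k x epowr q0 * w0 x epowr q0 \<partial>lebesgue) < \<infinity> \<and>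
          (\<integral>\<^sup>+x. g k x epowr p0 * w0 x epowr p0 \<partial>lebesgue) epowr (1 / p0)
            \<le> ennreal (D k) * (\<integral>\<^sup>+x. f k x epowr q0 * w0 x epowr q0 \<partial>lebesgue) epowr (1 / q0)"
    define C where "C k = real (Suc k) * D k" for k
    have C: "0 < C k" for k using D[of k] by (simp add: C_def)
    have "\<forall>k. \<exists>fg. fg \<in> F \<and> weighted_norm q w (fst fg) < \<infinity> \<and>
        ennreal (C k) * weighted_norm p w (snd fg) < weighted_norm q w (fst fg)"
    proof (intro allI, rule ccontr)
      fix k
      assume "\<nexists>fg. fg \<in> F \<and> weighted_norm q w (fst fg) < \<infinity> \<and>
        ennreal (C k) * weighted_norm p w (snd fg) < weighted_norm q w (fst fg)"
      then have "\<forall>(f, g)\<in>F. weighted_norm q w f < \<infinity> \<longrightarrow> weighted_norm q w f \<le> ennreal (C k) * weighted_norm p w g"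
        by (metis (mono_tags, lifting) case_prodI2 fst_conv not_le snd_conv)
      with C[of k] contra show False unfolding family_ineq_def by blast
    qed
    from choice[OF this] obtain fg where fg: "\<And>k. fg k \<in> F \<and> weighted_norm q w (fst (fg k)) < \<infinity> \<and>
        ennreal (C k) * weighted_norm p w (snd (fg k)) < weighted_norm q w (fst (fg k))" by blast
    define f where "f = (\<lambda>k. fst (fg k))"
    define g where "g = (\<lambda>k. snd (fg k))"
    have fg_F: "(f k, g k) \<in> F" for k using fg by (simp add: f_def g_def)
    then have [measurable]: "f k \<in> borel_measurable lebesgue" "g k \<in> borel_measurable lebesgue" for k
      using F by blast+
    define A where "A k = enn2real (weighted_norm q w (f k))" for k
    have f_norm: "var_norm q (\<lambda>x. f k x * w x) = ennreal (A k)" for k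
      using fg by (simp add: A_def f_def weighted_norm_def)
    have A: "0 < A k" for k
      using fg[of k] by (auto simp: A_def f_def enn2real_positive_iff intro: le_less_trans[OF zero_le])
    define t where "t k = A k / C k" for k
    have t: "0 < t k" for k using A C by (simp add: t_def)
    have g_norm: "var_norm p (\<lambda>x. g k x * w x) < ennreal (t k)" for k
    proof (rule ccontr)
      assume "\<not> ?thesis"
      then have "ennreal (C k) * ennreal (t k) \<le> ennreal (C k) * var_norm p (\<lambda>x. g k x * w x)"
        by (intro mult_left_mono) auto
      also have "\<dots> < ennreal (A k)"
        using fg[of k] f_norm[of k] by (simp add: f_def g_def weighted_norm_def)
      also have "ennreal (A k) = ennreal (C k) * ennreal (t k)"
        using C[of k] t[of k] by (subst ennreal_mult[symmetric]) (auto simp: t_def)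
      finally show False by simp
    qed
    \<comment> \<open>The bound \<open>2 * A k\<close> lies strictly above the norm of \<open>f k\<close>, and \<open>A k / 2\<close> strictly below it.\<close>
    define \<phi> where "\<phi> k x = ennreal (1 / (2 * A k)) * f k x" for k x
    define \<psi> where "\<psi> k x = ennreal (1 / t k) * g k x" for k x
    have "\<exists>w0\<in>A_const p0 q0. \<forall>k.
          0 < (\<integral>\<^sup>+x. \<phi> k x epowr q0 * w0 x epowr q0 \<partial>lebesgue) \<and>
          (\<integral>\<^sup>+x. \<phi> k x epowr q0 * w0 x epowr q0 \<partial>lebesgue) < \<infinity> \<and>
          (\<integral>\<^sup>+x. \<psi> k x epowr p0 * w0 x epowr p0 \<partial>lebesgue) epowr (1 / p0)
            \<le> ennreal (D k) * (\<integral>\<^sup>+x. \<phi> k x epowr q0 * w0 x epowr q0 \<partial>lebesgue) epowr (1 / q0)"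
    proof (rule weight)
      show "\<phi> k \<in> borel_measurable lebesgue" for k unfolding \<phi>_def by measurable
      show "(\<lambda>x. \<phi> k x * w x) \<in> unit_ball q" for k
      proof -
        have "(\<lambda>x. ennreal (1 / (2 * A k)) * (f k x * w x)) \<in> unit_ball q"
          using A[of k] by (intro var_norm_less[OF _ q]) (auto simp: f_norm intro!: ennreal_lessI)
        then show ?thesis by (simp add: \<phi>_def mult.assoc)
      qed
      show "(\<lambda>x. 4 * (\<phi> k x * w x)) \<notin> unit_ball q" for k
      proof
        have "4 * ennreal (1 / (2 * A k)) = ennreal (1 / (A k / 2))"
          using A[of k] unfolding ennreal_numeral[symmetric] by (subst ennreal_mult[symmetric]) auto
        then have "4 * (\<phi> k x * w x) = ennreal (1 / (A k / 2)) * (f k x * w x)" for x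
          by (simp only: \<phi>_def mult.assoc[symmetric])
        moreover assume "(\<lambda>x. 4 * (\<phi> k x * w x)) \<in> unit_ball q"
        ultimately have "var_norm q (\<lambda>x. f k x * w x) \<le> ennreal (A k / 2)"
          using A[of k] by (intro var_norm_le[OF _ _ q]) auto
        then show False using A[of k] by (simp add: f_norm)
      qed
      show "(\<lambda>x. \<psi> k x * w x) \<in> unit_ball p" for k
        using var_norm_less[OF g_norm p] by (simp add: \<psi>_def mult.assoc)
    qed
    then obtain w0 where w0: "w0 \<in> A_const p0 q0" and bounds: "\<And>k.
          0 < (\<integral>\<^sup>+x. \<phi> k x epowr q0 * w0 x epowr q0 \<partial>lebesgue)"
        "\<And>k. (\<integral>\<^sup>+x. \<phi> k x epowr q0 * w0 x epowr q0 \<partial>lebesgue) < \<infinity>"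
        "\<And>k. (\<integral>\<^sup>+x. \<psi> k x epowr p0 * w0 x epowr p0 \<partial>lebesgue) epowr (1 / p0)
            \<le> ennreal (D k) * (\<integral>\<^sup>+x. \<phi> k x epowr q0 * w0 x epowr q0 \<partial>lebesgue) epowr (1 / q0)"
      by blast
    have [measurable]: "w0 \<in> borel_measurable lebesgue"
      using w0 by (simp add: A_const_def)
    let ?L = "\<lambda>f. (\<integral>\<^sup>+x. f x epowr q0 * w0 x epowr q0 \<partial>lebesgue) epowr (1 / q0)"
    let ?R = "\<lambda>g. (\<integral>\<^sup>+x. g x epowr p0 * w0 x epowr p0 \<partial>lebesgue) epowr (1 / p0)"
    obtain C0 :: real where C0: "0 < C0"
      "\<forall>(f, g)\<in>F. ?L f < \<infinity> \<longrightarrow> ?L f \<le> ennreal C0 * ?R g"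
      using hyp[OF w0] unfolding family_ineq_def by blast
    obtain k :: nat where k: "C0 \<le> real k" using real_arch_simple by blast
    have "?L (\<phi> k) \<noteq> 0" "?L (\<phi> k) \<noteq> \<infinity>"
      using bounds(1,2)[of k] pos0 by (subst epowr_eq_0 epowr_eq_top; simp)+
    then obtain m where m: "?L (\<phi> k) = ennreal m" "0 < m"
      by (cases "?L (\<phi> k)" rule: ennreal_pos_cases) auto
    have L_\<phi>: "?L (\<phi> k) = ennreal (1 / (2 * A k)) * ?L (f k)"
      unfolding \<phi>_def using A[of k] pos0 by (intro scaled_power_integral) auto
    have "?L (f k) = ennreal (2 * A k) * (ennreal (1 / (2 * A k)) * ?L (f k))"
      using A[of k] unfolding mult.assoc[symmetric] by (subst ennreal_mult[symmetric]) auto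
    then have L_f: "?L (f k) = ennreal (2 * A k * m)"
      unfolding L_\<phi>[symmetric] m(1) using A[of k] m(2) by (simp add: ennreal_mult)
    have R_\<psi>: "?R (\<psi> k) = ennreal (1 / t k) * ?R (g k)"
      unfolding \<psi>_def using t[of k] pos0 by (intro scaled_power_integral) auto
    have "?R (g k) = ennreal (t k) * (ennreal (1 / t k) * ?R (g k))"
      using t[of k] unfolding mult.assoc[symmetric] by (subst ennreal_mult[symmetric]) auto
    also have "\<dots> \<le> ennreal (t k) * (ennreal (D k) * ennreal m)"
      unfolding R_\<psi>[symmetric] m(1)[symmetric] by (intro mult_left_mono bounds(3)) simp
    also have "\<dots> = ennreal (t k * D k * m)"
      using t[of k] D[of k] m(2) by (simp add: ennreal_mult mult.assoc)
    finally have R_g: "?R (g k) \<le> ennreal (t k * D k * m)" .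
    have "?L (f k) \<le> ennreal C0 * ?R (g k)"
      using C0(2) fg_F[of k] L_f by auto
    also have "\<dots> \<le> ennreal C0 * ennreal (t k * D k * m)"
      by (intro mult_left_mono R_g) simp
    also have "\<dots> = ennreal (C0 * (t k * D k * m))"
      using C0(1) t[of k] D[of k] m(2) by (simp add: ennreal_mult)
    finally have "2 * A k * m \<le> C0 * (t k * D k * m)"
      unfolding L_f using C0(1) t[of k] D[of k] m(2) by (subst (asm) ennreal_le_iff) auto
    also have "t k * D k = A k / real (Suc k)"
      using D[of k] by (simp add: t_def C_def)
    finally have "2 * (A k * m) \<le> (C0 / real (Suc k)) * (A k * m)"
      by (simp add: mult_ac)
    then have "2 \<le> C0 / real (Suc k)"
      using A[of k] m(2) by (subst (asm) mult_le_cancel_right_pos) auto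
    then show False using k by (simp add: field_simps)
  qed
qed

theorem theorem2p10:
  fixes F :: "((real ^ 'n \<Rightarrow> ennreal) \<times> (real ^ 'n \<Rightarrow> ennreal)) set"
    and p q w :: "real ^ 'n \<Rightarrow> ennreal"
    and p0 q0 \<sigma> :: real
  assumes F: "F \<subseteq> borel_measurable lebesgue \<times> borel_measurable lebesgue"
    and p0q0: "1 \<le> p0" "p0 \<le> q0"
    and hyp: "\<forall>w0 \<in> A_const p0 q0. family_ineq F
        (\<lambda>f. (\<integral>\<^sup>+x. f x epowr q0 * w0 x epowr q0 \<partial>lebesgue) epowr (1 / q0))
        (\<lambda>g. (\<integral>\<^sup>+x. g x epowr p0 * w0 x epowr p0 \<partial>lebesgue) epowr (1 / p0))"
    and pq: "p \<in> exponents" "q \<in> exponents"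
      "\<forall>x. enn2real (1 / p x) - enn2real (1 / q x) = 1 / p0 - 1 / q0"
    and sigma: "1 \<le> \<sigma>" "1 / conj_exp (ennreal \<sigma>) = ennreal (1 / p0 - 1 / q0)"
  shows "(1 < p0 \<longrightarrow>
            w \<in> A_var (1 / p0 - 1 / q0) p q \<longrightarrow>
            M_pair (\<lambda>x. q x / ennreal \<sigma>) (\<lambda>x. w x epowr \<sigma>) \<longrightarrow>
            family_ineq F (weighted_norm q w) (weighted_norm p w)) \<and>
         (p0 = 1 \<longrightarrow>
            w \<in> var_weights \<longrightarrow>
            maximal_bounded (\<lambda>x. conj_exp (q x / ennreal q0)) (\<lambda>x. w x epowr (- q0)) \<longrightarrow>
            family_ineq F (weighted_norm q w) (weighted_norm p w))"
proof -
  have "0 \<le> 1 / p0 - 1 / q0" using p0q0 by (simp add: field_simps)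
  moreover have "1 / ennreal \<sigma> = ennreal (1 / \<sigma>)"
    using sigma(1) divide_ennreal[of 1 \<sigma>] by simp
  moreover have "1 / ennreal \<sigma> + 1 / conj_exp (ennreal \<sigma>) = 1"
    using sigma(1) by (intro conj_exp_eq) simp
  ultimately have "ennreal (1 / \<sigma> + (1 / p0 - 1 / q0)) = ennreal 1"
    using sigma by (simp add: ennreal_plus)
  then have "1 / \<sigma> + (1 / p0 - 1 / q0) = 1"
    using \<open>0 \<le> 1 / p0 - 1 / q0\<close> sigma(1) by (subst (asm) ennreal_inj) auto
  then have \<sigma>: "1 / \<sigma> = 1 - (1 / p0 - 1 / q0)" by simp
  note extrapolate = extrapolation[OF F p0q0 bspec[OF hyp] sigma(1) \<sigma> pq(1,2) spec[OF pq(3)]]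
  show ?thesis
  proof (intro conjI impI)
    assume "1 < p0" and w: "w \<in> A_var (1 / p0 - 1 / q0) p q"
      and M: "M_pair (\<lambda>x. q x / ennreal \<sigma>) (\<lambda>x. w x epowr \<sigma>)"
    have "w \<in> var_weights" using w by (simp add: A_var_def)
    moreover have "maximal_bounded (\<lambda>x. q x / ennreal \<sigma>) (\<lambda>x. w x epowr \<sigma>)"
      "maximal_bounded (\<lambda>x. conj_exp (q x / ennreal \<sigma>)) (\<lambda>x. w x epowr (- \<sigma>))"
      using M by (simp_all add: M_pair_def epowr_epowr)
    ultimately show "family_ineq F (weighted_norm q w) (weighted_norm p w)"
      by - (rule extrapolate)
  next
    assume "p0 = 1" and w: "w \<in> var_weights"
      and M: "maximal_bounded (\<lambda>x. conj_exp (q x / ennreal q0)) (\<lambda>x. w x epowr (- q0))"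
    have "inverse \<sigma> = inverse q0" using \<sigma> \<open>p0 = 1\<close> by (simp add: inverse_eq_divide)
    then have "\<sigma> = q0" by simp
    show "family_ineq F (weighted_norm q w) (weighted_norm p w)"
      by (rule extrapolate[OF _ w]) (use \<open>p0 = 1\<close> M in \<open>simp_all add: \<open>\<sigma> = q0\<close>\<close>)
  qed
qed

end
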